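(* Let $c,\eta>0$, $\mu_k>0$, $\mathbf{Y}_k\in\mathbb{Q}^{n_1\times n_2}$, $n_{(2)}=\min\{n_1,n_2\}$, and let $\mathbf{Y}_k=\mathbf{U}_k\mathbf{\Sigma}_k\mathbf{V}_k^*$ be the quaternion singular value decomposition of $\mathbf{Y}_k$. Then an optimal solution of the minimization problem $$\min_{\mathbf{L}\in\mathbb{Q}^{n_1\times n_2}}\ \frac{1}{\mu_k}\|\mathbf{L}\|_{\mathrm{MCP}}+\frac12\|\mathbf{L}-\mathbf{Y}_k\|_F^2$$ is given by $\mathbf{L}_\clubsuit=\mathbf{U}_k\,\mathbf{\Sigma}_{\frac{1}{\mu_k}\Phi_{c,\eta}}\mathbf{V}_k^*$, where $$\mathbf{\Sigma}_{\frac{1}{\mu_k}\Phi_{c,\eta}}=\mathrm{Diag}\Big(\mathrm{Prox}_{\frac{1}{\mu_k}\Phi_{c,\eta}}\big((\mathbf{\Sigma}_k)_{1,1}\big),\ldots,\mathrm{Prox}_{\frac{1}{\mu_k}\Phi_{c,\eta}}\big((\mathbf{\Sigma}_k)_{n_{(2)},n_{(2)}}\big)\Big)\in\mathbb{R}^{n_1\times n_2}$$ and $(\mathbf{\Sigma}_k)_{i,i}$ is the $(i,i)$th entry of $\mathbf{\Sigma}_k$.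
   Context: $\mathbb{Q}$ denotes the real quaternions; $\mathbf{A}^*$ is the conjugate transpose of a quaternion matrix, and $\|\mathbf{A}\|_F=\big(\sum_{i,j}|\mathbf{a}_{ij}|^2\big)^{1/2}$. The quaternion singular value decomposition (QSVD) of $\mathbf{X}\in\mathbb{Q}^{n_1\times n_2}$ is $\mathbf{X}=\mathbf{U}\mathbf{\Sigma}\mathbf{V}^*$ with $\mathbf{U}\in\mathbb{Q}^{n_1\times n_1}$, $\mathbf{V}\in\mathbb{Q}^{n_2\times n_2}$ unitary and $\mathbf{\Sigma}\in\mathbb{R}^{n_1\times n_2}$ (rectangular) diagonal with diagonal entries the singular values $\sigma_1(\mathbf{X})\ge\cdots\ge\sigma_{n_{(2)}}(\mathbf{X})\ge 0$. For $c,\eta>0$ the MCP function $\Phi_{c,\eta}:\mathbb{R}\to\mathbb{R}$ is the even function given on $[0,\infty)$ by $\Phi_{c,\eta}(x)=cx-\frac{1}{2\eta}x^2$ if $0\le x\le c\eta$ and $\Phi_{c,\eta}(x)=\frac{c^2\eta}{2}$ if $x>c\eta$. For $\mathbf{X}\in\mathbb{Q}^{n_1\times n_2}$, $\|\mathbf{X}\|_{\mathrm{MCP}}=\sum_{i=1}^{n_{(2)}}\Phi_{c,\eta}(\sigma_i(\mathbf{X}))$. For a proper lower semicontinuous $f:\mathbb{R}\to(-\infty,+\infty]$, the proximal mapping is $\mathrm{Prox}_f(y)=\arg\min_{x\in\mathbb{R}}\{f(x)+\frac12(x-y)^2\}$; when the minimizer is not unique, $\mathrm{Prox}_f(y)$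 stands for any chosen minimizer. *)

theory Defs
  imports "HOL-Analysis.Analysis" "Jordan_Normal_Form.Matrix"
begin

section \<open>The real quaternions\<close>

codatatype quat = Quat (qRe: real) (qIm1: real) (qIm2: real) (qIm3: real)

lemma quat_eq_iff:
  "x = y \<longleftrightarrow> qRe x = qRe y \<and> qIm1 x = qIm1 y \<and> qIm2 x = qIm2 y \<and> qIm3 x = qIm3 y"
  by (auto intro: quat.expand)

instantiation quat :: ring_1
begin

primcorec zero_quat where
  "qRe 0 = 0" | "qIm1 0 = 0" | "qIm2 0 = 0" | "qIm3 0 = 0"

primcorec one_quat where
  "qRe 1 = 1" | "qIm1 1 = 0" | "qIm2 1 = 0" | "qIm3 1 = 0"

primcorec plus_quat where
  "qRe (x + y) = qRe x + qRe y"
| "qIm1 (x + y) = qIm1 x + qIm1 y"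
| "qIm2 (x + y) = qIm2 x + qIm2 y"
| "qIm3 (x + y) = qIm3 x + qIm3 y"

primcorec uminus_quat where
  "qRe (- x) = - qRe x"
| "qIm1 (- x) = - qIm1 x"
| "qIm2 (- x) = - qIm2 x"
| "qIm3 (- x) = - qIm3 x"

primcorec minus_quat where
  "qRe (x - y) = qRe x - qRe y"
| "qIm1 (x - y) = qIm1 x - qIm1 y"
| "qIm2 (x - y) = qIm2 x - qIm2 y"
| "qIm3 (x - y) = qIm3 x - qIm3 y"

primcorec times_quat where
  "qRe (x * y) = qRe x * qRe y - qIm1 x * qIm1 y - qIm2 x * qIm2 y - qIm3 x * qIm3 y"
| "qIm1 (x * y) = qRe x * qIm1 y + qIm1 x * qRe y + qIm2 x * qIm3 y - qIm3 x * qIm2 y"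
| "qIm2 (x * y) = qRe x * qIm2 y - qIm1 x * qIm3 y + qIm2 x * qRe y + qIm3 x * qIm1 y"
| "qIm3 (x * y) = qRe x * qIm3 y + qIm1 x * qIm2 y - qIm2 x * qIm1 y + qIm3 x * qRe y"

instance
  by standard (simp_all add: quat_eq_iff algebra_simps)

end

instantiation quat :: real_algebra_1
begin

primcorec scaleR_quat where
  "qRe (scaleR r x) = r * qRe x"
| "qIm1 (scaleR r x) = r * qIm1 x"
| "qIm2 (scaleR r x) = r * qIm2 x"
| "qIm3 (scaleR r x) = r * qIm3 x"

instance
  by standard (simp_all add: quat_eq_iff algebra_simps)

end

text \<open>The norm supplied by the class \<^class>\<open>real_inner\<close> is the modulus of a quaternion,
  see \<open>norm_quat_eq\<close> below.\<close>

instantiation quat :: real_inner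
begin

definition inner_quat :: "quat \<Rightarrow> quat \<Rightarrow> real" where
  "inner_quat x y = qRe x * qRe y + qIm1 x * qIm1 y + qIm2 x * qIm2 y + qIm3 x * qIm3 y"

definition norm_quat :: "quat \<Rightarrow> real" where
  "norm_quat x = sqrt (inner x x)"

definition sgn_quat :: "quat \<Rightarrow> quat" where
  "sgn_quat x = x /\<^sub>R norm x"

definition dist_quat :: "quat \<Rightarrow> quat \<Rightarrow> real" where
  "dist_quat x y = norm (x - y)"

definition uniformity_quat :: "(quat \<times> quat) filter" where
  "uniformity_quat = (INF e\<in>{0 <..}. principal {(x, y). dist x y < e})"

definition open_quat :: "quat set \<Rightarrow> bool" where
  "open_quat U \<longleftrightarrow> (\<forall>x\<in>U. eventually (\<lambda>(x', y). x' = x \<longrightarrow> y \<in> U) uniformity)"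

instance
proof
  fix x y z :: quat and r :: real and U :: "quat set"
  show "inner x x = 0 \<longleftrightarrow> x = 0"
    by (simp add: inner_quat_def quat_eq_iff add_nonneg_eq_0_iff)
qed (simp_all add: inner_quat_def norm_quat_def sgn_quat_def dist_quat_def
       uniformity_quat_def open_quat_def algebra_simps)

end

lemma norm_quat_eq:
  "norm (x::quat) = sqrt ((qRe x)\<^sup>2 + (qIm1 x)\<^sup>2 + (qIm2 x)\<^sup>2 + (qIm3 x)\<^sup>2)"
  by (simp add: norm_quat_def inner_quat_def power2_eq_square)

instantiation quat :: conjugate
begin

primcorec conjugate_quat where
  "qRe (conjugate x) = qRe x"
| "qIm1 (conjugate x) = - qIm1 x"
| "qIm2 (conjugate x) = - qIm2 x"
| "qIm3 (conjugate x) = - qIm3 x"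

instance
  by standard (simp_all add: quat_eq_iff)

end

lemma conjugate_quat_mult: "conjugate (x * y) = conjugate y * conjugate (x::quat)"
  by (simp add: quat_eq_iff algebra_simps)

lemma quat_mult_conjugate: "x * conjugate x = of_real ((norm (x::quat))\<^sup>2)"
  by (simp add: quat_eq_iff norm_quat_eq of_real_def power2_eq_square algebra_simps)


section \<open>Quaternion matrices and their singular values\<close>

text \<open>The library's \<open>mat_adjoint\<close> is restricted to commutative fields.\<close>

definition quat_adjoint :: "quat mat \<Rightarrow> quat mat" where
  "quat_adjoint A = map_mat conjugate (transpose_mat A)"

definition quat_unitary :: "nat \<Rightarrow> quat mat \<Rightarrow> bool" where
  "quat_unitary n U \<longleftrightarrow> U \<in> carrier_mat n n \<and>
     U * quat_adjoint U = 1\<^sub>m n \<and> quat_adjoint U * U = 1\<^sub>m n"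

definition frob_norm :: "quat mat \<Rightarrow> real" where
  "frob_norm A = sqrt (\<Sum>i<dim_row A. \<Sum>j<dim_col A. (norm (A $$ (i, j)))\<^sup>2)"

text \<open>Indices are zero-based, so the \<open>(i+1)\<close>-st singular value is entry \<open>(i, i)\<close>.\<close>

definition is_qsvd :: "quat mat \<Rightarrow> quat mat \<Rightarrow> real mat \<Rightarrow> quat mat \<Rightarrow> bool" where
  "is_qsvd X U S V \<longleftrightarrow>
     quat_unitary (dim_row X) U \<and> quat_unitary (dim_col X) V \<and>
     S \<in> carrier_mat (dim_row X) (dim_col X) \<and> diagonal_mat S \<and>
     (\<forall>i < min (dim_row X) (dim_col X). 0 \<le> S $$ (i, i)) \<and>
     (\<forall>i j. i \<le> j \<longrightarrow> j < min (dim_row X) (dim_col X) \<longrightarrow> S $$ (j, j) \<le> S $$ (i, i)) \<and>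
     X = U * map_mat of_real S * quat_adjoint V"

text \<open>Every quaternion matrix has such a decomposition, and its middle factor is unique
  (the unitary factors are not), so the description below always denotes.\<close>

definition sing_val :: "quat mat \<Rightarrow> nat \<Rightarrow> real" where
  "sing_val X i = (THE S. \<exists>U V. is_qsvd X U S V) $$ (i, i)"

definition rect_diag :: "nat \<Rightarrow> nat \<Rightarrow> (nat \<Rightarrow> real) \<Rightarrow> real mat" where
  "rect_diag m n d = mat m n (\<lambda>(i, j). if i = j then d i else 0)"


section \<open>The MCP function and the proximal mapping\<close>

definition mcp :: "real \<Rightarrow> real \<Rightarrow> real \<Rightarrow> real" where
  "mcp c \<eta> x = (if \<bar>x\<bar> \<le> c * \<eta> then c * \<bar>x\<bar> - 1 / (2 * \<eta>) * \<bar>x\<bar>\<^sup>2 else c\<^sup>2 * \<eta> / 2)"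

definition mcp_norm :: "real \<Rightarrow> real \<Rightarrow> quat mat \<Rightarrow> real" where
  "mcp_norm c \<eta> X = (\<Sum>i < min (dim_row X) (dim_col X). mcp c \<eta> (sing_val X i))"

text \<open>Minimizers need not be unique, hence the proximal mapping is set-valued.\<close>

definition prox :: "(real \<Rightarrow> ereal) \<Rightarrow> real \<Rightarrow> real set" where
  "prox f y = {x. is_arg_min (\<lambda>x. f x + ereal (1 / 2 * (x - y)\<^sup>2)) (\<lambda>_. True) x}"

lemma mcp_nonneg:
  assumes "0 < c" "0 < \<eta>"
  shows "0 \<le> mcp c \<eta> x"
proof (cases "\<bar>x\<bar> \<le> c * \<eta>")
  case True
  then have "\<bar>x\<bar> * \<bar>x\<bar> \<le> (c * \<eta>) * \<bar>x\<bar>"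
    by (intro mult_right_mono) auto
  moreover have "0 \<le> c * \<eta> * \<bar>x\<bar>"
    using assms by simp
  ultimately have "\<bar>x\<bar> * \<bar>x\<bar> \<le> 2 * (c * \<eta> * \<bar>x\<bar>)"
    by linarith
  with True assms show ?thesis
    by (simp add: mcp_def power2_eq_square field_simps)
next
  case False
  with assms show ?thesis by (simp add: mcp_def)
qed

lemma mcp_eq_min:
  assumes "0 < c" "0 < \<eta>"
  shows "mcp c \<eta> x = c * min \<bar>x\<bar> (c * \<eta>) - 1 / (2 * \<eta>) * (min \<bar>x\<bar> (c * \<eta>))\<^sup>2"
  using assms by (auto simp: mcp_def min_def power2_eq_square field_simps)

lemma continuous_on_mcp:
  assumes "0 < c" "0 < \<eta>"
  shows "continuous_on A (mcp c \<eta>)"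
proof -
  have "continuous_on A
      (\<lambda>x. c * min \<bar>x\<bar> (c * \<eta>) - 1 / (2 * \<eta>) * (min \<bar>x\<bar> (c * \<eta>))\<^sup>2)"
    by (intro continuous_intros)
  then show ?thesis
    using mcp_eq_min[OF assms] by (simp cong: continuous_on_cong)
qed

lemma prox_mcp_nonempty:
  assumes "0 < c" "0 < \<eta>" "0 < \<mu>"
  shows "prox (\<lambda>x. ereal (1 / \<mu> * mcp c \<eta> x)) y \<noteq> {}"
proof -
  define h where "h = (\<lambda>x. 1 / \<mu> * mcp c \<eta> x)"
  define g where "g = (\<lambda>x. h x + 1 / 2 * (x - y)\<^sup>2)"
  define R where "R = sqrt (2 * h y)"
  have h0: "0 \<le> h x" for x
    using mcp_nonneg[OF assms(1,2)] assms(3) by (simp add: h_def)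
  have R0: "0 \<le> R" and R2: "R\<^sup>2 = 2 * h y"
    using h0[of y] by (simp_all add: R_def)
  have "continuous_on (cball y R) g"
    unfolding g_def h_def
    by (intro continuous_intros continuous_on_mcp assms)
  moreover have "compact (cball y R)" "cball y R \<noteq> {}"
    using R0 by auto
  ultimately obtain x where x: "x \<in> cball y R" "\<forall>z\<in>cball y R. g x \<le> g z"
    using continuous_attains_inf by blast
  have "g x \<le> g z" for z
  proof (cases "z \<in> cball y R")
    case True
    with x show ?thesis by blast
  next
    case False
    then have "R\<^sup>2 \<le> \<bar>z - y\<bar>\<^sup>2"
      using R0 by (intro power_mono) (auto simp: dist_real_def)
    then have "h y \<le> 1 / 2 * (z - y)\<^sup>2"
      using R2 by simp
    then have "g y \<le> g z"
      using h0[of z] by (simp add: g_def)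
    moreover have "g x \<le> g y"
      using x R0 by simp
    ultimately show ?thesis by simp
  qed
  then have "x \<in> prox (\<lambda>x. ereal (1 / \<mu> * mcp c \<eta> x)) y"
    by (simp add: prox_def is_arg_min_linorder g_def h_def)
  then show ?thesis by blast
qed

end

theory Submission
  imports Defs
begin

text \<open>Let \<open>s\<close> be the singular values of \<open>Y\<close>. The candidate has the same unitary factors as
  \<open>Y\<close>, so its objective value is the sum of the scalar proximal problems' optimal values
  (\<open>mcp_norm_real_diag\<close> and \<open>frob_norm_unitary_diff\<close>). It remains to bound the objective at
  an arbitrary \<open>L\<close> with singular values \<open>t\<close> from below by this number, which is
  \<open>separable_prox_lower_bound\<close>.

  The inner product of \<open>L\<close> and \<open>Y\<close> is at most the sum of \<open>M i j * t i * s j\<close> for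
  some doubly substochastic matrix \<open>M\<close> (\<open>mat_inner_diag_le_doubly_substochastic\<close>). That
  suffices, because the scalar optimality of the proximal points gives a lower bound for every pair
  \<open>(t i, s j)\<close>, not just for \<open>i = j\<close>, and these bounds can be averaged with the weights
  \<open>M i j\<close>.

  For the objective to be computed at all, singular values must be well defined. Uniqueness
  (\<open>is_qsvd_unique\<close>) follows from an invariance statement (\<open>real_diag_invariant\<close>): in any
  two decompositions with unitary outer factors and a real diagonal middle one, the squares of the
  diagonals are the same up to order. The same statement evaluates the MCP norm of the candidate,
  whose diagonal need not be sorted when minimizers of the scalar problems are not unique.
  For existence (\<open>qsvd_exists\<close>), the real trace pairing of \<open>U A V\<^sup>*\<close> with the given
  matrix is maximized over all pairs of unitary matrices, where \<open>A\<close> is diagonal with strictly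
  decreasing positive entries. The optimality conditions force the transformed matrix to be diagonal, nonnegative and sorted.\<close>

section \<open>Quaternion arithmetic\<close>

lemma conjugate_quat_add: "conjugate (x + y) = conjugate x + conjugate (y::quat)"
  by (simp add: quat_eq_iff)

lemma conjugate_quat_zero: "conjugate 0 = (0::quat)"
  by (simp add: quat_eq_iff)

lemma conjugate_quat_one: "conjugate 1 = (1::quat)"
  by (simp add: quat_eq_iff)

lemma conjugate_quat_scaleR: "conjugate (r *\<^sub>R x) = r *\<^sub>R conjugate (x::quat)"
  by (simp add: quat_eq_iff)

lemma conjugate_quat_of_real: "conjugate (of_real r) = (of_real r :: quat)"
  by (simp add: quat_eq_iff of_real_def)

lemma conjugate_quat_sum: "conjugate (sum f A) = (\<Sum>x\<in>A. conjugate (f x :: quat))"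
  by (induction A rule: infinite_finite_induct)
     (auto simp: conjugate_quat_add conjugate_quat_zero)

lemma norm_conjugate_quat: "norm (conjugate x) = norm (x::quat)"
  by (simp add: norm_quat_eq)

lemma quat_conjugate_mult_self: "conjugate x * x = of_real ((norm (x::quat))\<^sup>2)"
  using quat_mult_conjugate[of "conjugate x"] by (simp add: norm_conjugate_quat)

lemma inner_quat_mult_left: "inner (x * y) z = inner y (conjugate x * (z::quat))"
  by (simp add: inner_quat_def algebra_simps)

lemma inner_quat_mult_right: "inner (x * y) z = inner x (z * conjugate (y::quat))"
  by (simp add: inner_quat_def algebra_simps)

lemma norm_quat_mult: "norm (x * y) = norm x * norm (y::quat)"
proof -
  have "(norm (x * y))\<^sup>2 = (norm x * norm y)\<^sup>2"
    by (simp only: power2_norm_eq_inner power_mult_distrib inner_quat_mult_left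
      mult.assoc[symmetric] quat_conjugate_mult_self scaleR_conv_of_real[symmetric] inner_scaleR_right)
  then show ?thesis by (rule power2_eq_imp_eq) simp_all
qed

instance quat :: real_normed_algebra_1
proof
  show "norm (1::quat) = 1" by (simp add: norm_quat_eq)
qed (simp add: norm_quat_mult)

section \<open>Quaternion matrices\<close>

lemma quat_adjoint_carrier:
  "A \<in> carrier_mat n m \<Longrightarrow> quat_adjoint A \<in> carrier_mat m n"
  by (auto simp: quat_adjoint_def)

lemma quat_adjoint_index:
  "A \<in> carrier_mat n m \<Longrightarrow> i < m \<Longrightarrow> j < n \<Longrightarrow> quat_adjoint A $$ (i, j) = conjugate (A $$ (j, i))"
  by (auto simp: quat_adjoint_def)

lemma mult_mat_index:
  assumes "A \<in> carrier_mat n m" "B \<in> carrier_mat m p" "i < n" "j < p"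
  shows "(A * B) $$ (i, j) = (\<Sum>k<m. A $$ (i, k) * B $$ (k, j))"
  using assms by (simp add: scalar_prod_def atLeast0LessThan)

lemma quat_adjoint_adjoint: "quat_adjoint (quat_adjoint A) = A"
  by (rule eq_matI) (auto simp: quat_adjoint_def)

lemma quat_adjoint_mult:
  assumes "A \<in> carrier_mat n m" "B \<in> carrier_mat m p"
  shows "quat_adjoint (A * B) = quat_adjoint B * quat_adjoint A"
proof (rule eq_matI, goal_cases)
  case (1 i j)
  with assms have "i < p" "j < n" by (auto simp: quat_adjoint_def)
  then show ?case using assms
    by (simp add: quat_adjoint_index[of _ n p] quat_adjoint_index[of _ m p] quat_adjoint_index[of _ n m]
      mult_mat_index[of _ n m _ p] mult_mat_index[of _ p m _ n] quat_adjoint_carrier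
      conjugate_quat_sum conjugate_quat_mult del: index_mult_mat)
qed (use assms in \<open>auto simp: quat_adjoint_def\<close>)

text \<open>The real part of the trace of \<open>A\<^sup>* B\<close>. Taking the real part
  restores the cyclic invariance that the quaternion trace lacks, so a factor can be moved to the other
  argument as its adjoint. All traces below are handled in this form.\<close>

definition mat_inner :: "quat mat \<Rightarrow> quat mat \<Rightarrow> real" where
  "mat_inner A B = (\<Sum>i<dim_row A. \<Sum>j<dim_col A. inner (A $$ (i, j)) (B $$ (i, j)))"

lemma mat_inner_carrier:
  "A \<in> carrier_mat n m \<Longrightarrow>
    mat_inner A B = (\<Sum>i<n. \<Sum>j<m. inner (A $$ (i, j)) (B $$ (i, j)))"
  by (auto simp: mat_inner_def)

lemma frob_norm_power2: "(frob_norm A)\<^sup>2 = mat_inner A A"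
  by (simp add: frob_norm_def mat_inner_def sum_nonneg power2_norm_eq_inner)

lemma mat_inner_commute:
  "A \<in> carrier_mat n m \<Longrightarrow> B \<in> carrier_mat n m \<Longrightarrow> mat_inner A B = mat_inner B A"
  by (simp add: mat_inner_carrier inner_commute)

lemma mat_inner_diff_self:
  assumes "A \<in> carrier_mat n m" "B \<in> carrier_mat n m"
  shows "mat_inner (A - B) (A - B) = mat_inner A A - 2 * mat_inner A B + mat_inner B B"
  using assms minus_carrier_mat[OF assms(2), of A]
  by (simp add: mat_inner_carrier[of _ n m] inner_diff_left inner_diff_right
      inner_commute[of "B $$ _" "A $$ _"] sum.distrib sum_subtractf sum_distrib_left[symmetric])

lemma mat_inner_mult_left:
  assumes "U \<in> carrier_mat n q" "A \<in> carrier_mat q m" "B \<in> carrier_mat n m"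
  shows "mat_inner (U * A) B = mat_inner A (quat_adjoint U * B)"
proof -
  have "mat_inner (U * A) B = (\<Sum>i<n. \<Sum>j<m. \<Sum>k<q. inner (U $$ (i, k) * A $$ (k, j)) (B $$ (i, j)))"
    using assms by (simp add: mat_inner_carrier[of _ n m] mult_mat_index[of _ n q _ m] inner_sum_left
      del: index_mult_mat)
  also have "\<dots> = (\<Sum>i<n. \<Sum>k<q. \<Sum>j<m. inner (U $$ (i, k) * A $$ (k, j)) (B $$ (i, j)))"
    by (intro sum.cong refl sum.swap)
  also have "\<dots> = (\<Sum>k<q. \<Sum>i<n. \<Sum>j<m. inner (U $$ (i, k) * A $$ (k, j)) (B $$ (i, j)))"
    by (rule sum.swap)
  also have "\<dots> = (\<Sum>k<q. \<Sum>j<m. \<Sum>i<n. inner (U $$ (i, k) * A $$ (k, j)) (B $$ (i, j)))"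
    by (intro sum.cong refl sum.swap)
  also have "\<dots> = mat_inner A (quat_adjoint U * B)"
    using assms quat_adjoint_carrier[OF assms(1)]
    by (simp add: mat_inner_carrier[of _ q m] mult_mat_index[of _ q n _ m] inner_sum_right
      inner_quat_mult_left quat_adjoint_index[of _ n q] del: index_mult_mat)
  finally show ?thesis .
qed

lemma mat_inner_mult_right:
  assumes "A \<in> carrier_mat n q" "V \<in> carrier_mat q m" "B \<in> carrier_mat n m"
  shows "mat_inner (A * V) B = mat_inner A (B * quat_adjoint V)"
proof -
  have "mat_inner (A * V) B = (\<Sum>i<n. \<Sum>j<m. \<Sum>k<q. inner (A $$ (i, k) * V $$ (k, j)) (B $$ (i, j)))"
    using assms by (simp add: mat_inner_carrier[of _ n m] mult_mat_index[of _ n q _ m] inner_sum_left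
      del: index_mult_mat)
  also have "\<dots> = (\<Sum>i<n. \<Sum>k<q. \<Sum>j<m. inner (A $$ (i, k) * V $$ (k, j)) (B $$ (i, j)))"
    by (intro sum.cong refl sum.swap)
  also have "\<dots> = mat_inner A (B * quat_adjoint V)"
    using assms quat_adjoint_carrier[OF assms(2)]
    by (simp add: mat_inner_carrier[of _ n q] mult_mat_index[of _ n m _ q] inner_sum_right
      inner_quat_mult_right quat_adjoint_index[of _ q m] del: index_mult_mat)
  finally show ?thesis .
qed

lemma quat_unitaryD:
  assumes "quat_unitary n U"
  shows "U \<in> carrier_mat n n" "quat_adjoint U \<in> carrier_mat n n"
    "U * quat_adjoint U = 1\<^sub>m n" "quat_adjoint U * U = 1\<^sub>m n"
  using assms quat_adjoint_carrier[of U n n] by (auto simp: quat_unitary_def)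

lemma quat_unitary_adjoint: "quat_unitary n U \<Longrightarrow> quat_unitary n (quat_adjoint U)"
  by (simp add: quat_unitary_def quat_adjoint_adjoint quat_adjoint_carrier)

lemma quat_unitary_one: "quat_unitary n (1\<^sub>m n)"
proof -
  have "quat_adjoint (1\<^sub>m n) = 1\<^sub>m n"
    by (rule eq_matI) (auto simp: quat_adjoint_def conjugate_quat_one conjugate_quat_zero)
  then show ?thesis by (simp add: quat_unitary_def)
qed

lemma quat_unitary_mult:
  assumes U: "quat_unitary n U" and V: "quat_unitary n V"
  shows "quat_unitary n (U * V)"
proof -
  note c = quat_unitaryD(1,2)[OF U] quat_unitaryD(1,2)[OF V]
  have "U * V * quat_adjoint (U * V) = U * (V * quat_adjoint V) * quat_adjoint U"
    using c by (simp add: quat_adjoint_mult[of _ n n _ n] assoc_mult_mat[of _ n n _ n _ n])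
  moreover have "quat_adjoint (U * V) * (U * V) = quat_adjoint V * (quat_adjoint U * U) * V"
    using c by (simp add: quat_adjoint_mult[of _ n n _ n] assoc_mult_mat[of _ n n _ n _ n])
  ultimately show ?thesis
    using c quat_unitaryD[OF U] quat_unitaryD[OF V] by (simp add: quat_unitary_def)
qed

lemma quat_unitary_cancel:
  assumes "quat_unitary n U"
  shows "A \<in> carrier_mat n m \<Longrightarrow> quat_adjoint U * (U * A) = A"
    "A \<in> carrier_mat n m \<Longrightarrow> U * (quat_adjoint U * A) = A"
    "A \<in> carrier_mat m n \<Longrightarrow> A * U * quat_adjoint U = A"
    "A \<in> carrier_mat m n \<Longrightarrow> A * quat_adjoint U * U = A"
  using quat_unitaryD[OF assms] assoc_mult_mat[of "quat_adjoint U" n n U n A m]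
    assoc_mult_mat[of U n n "quat_adjoint U" n A m] assoc_mult_mat[of A m n U n "quat_adjoint U" n]
    assoc_mult_mat[of A m n "quat_adjoint U" n U n]
  by simp_all

lemma quat_unitary_row_norm:
  assumes "quat_unitary n U" "i < n"
  shows "(\<Sum>j<n. (norm (U $$ (i, j)))\<^sup>2) = 1"
proof -
  note c = quat_unitaryD[OF assms(1)]
  have "(1\<^sub>m n :: quat mat) $$ (i, i) = (\<Sum>j<n. of_real ((norm (U $$ (i, j)))\<^sup>2))"
    unfolding c(3)[symmetric] using c(1,2) assms(2)
    by (simp add: mult_mat_index[of _ n n _ n] quat_adjoint_index[of _ n n] quat_mult_conjugate
      del: index_mult_mat)
  then have "of_real (\<Sum>j<n. (norm (U $$ (i, j)))\<^sup>2) = (of_real 1 :: quat)"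
    unfolding of_real_sum using assms(2) by simp
  then show ?thesis unfolding of_real_eq_iff .
qed

lemma quat_unitary_col_norm:
  assumes "quat_unitary n U" "j < n"
  shows "(\<Sum>i<n. (norm (U $$ (i, j)))\<^sup>2) = 1"
  using quat_unitary_row_norm[OF quat_unitary_adjoint[OF assms(1)] assms(2)]
    quat_unitaryD[OF assms(1)] assms(2)
  by (simp add: quat_adjoint_index[of _ n n] norm_conjugate_quat)

lemma unitary_conj_carrier:
  assumes U: "quat_unitary n U" and V: "quat_unitary m V" and A: "A \<in> carrier_mat n m"
  shows "U * A * quat_adjoint V \<in> carrier_mat n m"
  using quat_unitaryD(1)[OF U] quat_unitaryD(2)[OF V] A by (meson mult_carrier_mat)

lemma mat_inner_unitary_conj:
  assumes U: "quat_unitary n U" and V: "quat_unitary m V"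
    and A: "A \<in> carrier_mat n m" and B: "B \<in> carrier_mat n m"
  shows "mat_inner (U * A * quat_adjoint V) B = mat_inner A (quat_adjoint U * B * V)"
proof -
  note c = quat_unitaryD(1,2)[OF U] quat_unitaryD(1,2)[OF V]
  have "mat_inner (U * A * quat_adjoint V) B = mat_inner (U * A) (B * V)"
    using mat_inner_mult_right[of "U * A" n m "quat_adjoint V" m B] c A B
    by (simp add: quat_adjoint_adjoint)
  also have "\<dots> = mat_inner A (quat_adjoint U * (B * V))"
    using mat_inner_mult_left[of U n n A m "B * V"] c A B by simp
  finally show ?thesis using c B by (simp add: assoc_mult_mat[of _ n n _ m _ m])
qed

section \<open>Real diagonal matrices\<close>

abbreviation diag_quat :: "nat \<Rightarrow> nat \<Rightarrow> (nat \<Rightarrow> real) \<Rightarrow> quat mat" where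
  "diag_quat n m d \<equiv> map_mat of_real (rect_diag n m d)"

lemma rect_diag_carrier [simp]: "rect_diag n m d \<in> carrier_mat n m"
  by (simp add: rect_diag_def)

lemma diag_quat_carrier: "diag_quat n m d \<in> carrier_mat n m"
  by simp

lemma diag_quat_index:
  "i < n \<Longrightarrow> j < m \<Longrightarrow> diag_quat n m d $$ (i, j) = (if i = j then of_real (d i) else 0)"
  by (simp add: rect_diag_def)

lemma mult_diag_quat_index:
  assumes "A \<in> carrier_mat l n" "i < l" "j < m"
  shows "(A * diag_quat n m d) $$ (i, j) = (if j < n then d j *\<^sub>R A $$ (i, j) else 0)"
proof -
  have "(A * diag_quat n m d) $$ (i, j) = (\<Sum>k<n. if k = j then d j *\<^sub>R A $$ (i, j) else 0)"
    unfolding mult_mat_index[OF assms(1) diag_quat_carrier assms(2,3)]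
    using assms(3) by (intro sum.cong refl) (simp add: diag_quat_index of_real_def del: index_map_mat)
  then show ?thesis by simp
qed

lemma diag_quat_mult_index:
  assumes "A \<in> carrier_mat m l" "i < n" "j < l"
  shows "(diag_quat n m d * A) $$ (i, j) = (if i < m then d i *\<^sub>R A $$ (i, j) else 0)"
proof -
  have "(diag_quat n m d * A) $$ (i, j) = (\<Sum>k<m. if k = i then d i *\<^sub>R A $$ (i, j) else 0)"
    unfolding mult_mat_index[OF diag_quat_carrier assms]
    using assms(2) by (intro sum.cong refl) (auto simp: diag_quat_index of_real_def simp del: index_map_mat)
  then show ?thesis by simp
qed

lemma mat_inner_diag_quat:
  "mat_inner (diag_quat n m d) B = (\<Sum>i<min n m. d i * qRe (B $$ (i, i)))"
proof -
  have "mat_inner (diag_quat n m d) B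
    = (\<Sum>i<n. \<Sum>j<m. if j = i then d i * qRe (B $$ (i, i)) else 0)"
    unfolding mat_inner_carrier[OF diag_quat_carrier]
    by (intro sum.cong refl)
      (simp add: diag_quat_index inner_quat_def of_real_def del: index_map_mat)
  also have "\<dots> = (\<Sum>i<n. if i < m then d i * qRe (B $$ (i, i)) else 0)"
    by simp
  also have "\<dots> = (\<Sum>i\<in>{..<n} \<inter> {i. i < m}. d i * qRe (B $$ (i, i)))"
    by (simp add: sum.inter_restrict)
  also have "{..<n} \<inter> {i. i < m} = {..<min n m}" by auto
  finally show ?thesis .
qed

section \<open>Unitary invariance of the singular values\<close>

text \<open>Put \<open>W = U'\<^sup>* U\<close> and \<open>Z = V'\<^sup>* V\<close>. The
  hypothesis gives \<open>W D = D' Z\<close> and \<open>W\<^sup>* D' = D Z\<^sup>*\<close>; eliminating \<open>Z\<close>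
  shows that \<open>W\<close> intertwines the diagonal matrices of squares, padded with zeros to order
  \<open>n\<close>. So the entry \<open>(i, j)\<close> of \<open>W\<close> vanishes unless the
  \<open>i\<close>-th and the \<open>j\<close>-th squares agree. The squared moduli of the entries of \<open>W\<close>
  form a doubly stochastic matrix, and averaging \<open>f\<close> with it along rows and along columns gives
  the two sums. The entries may be unordered and of either sign, which is what allows the lemma to
  be applied to the values of the proximal mapping.\<close>

lemma real_diag_invariant:
  fixes f :: "real \<Rightarrow> real"
  assumes U: "quat_unitary n U" and V: "quat_unitary m V"
    and U': "quat_unitary n U'" and V': "quat_unitary m V'"
    and eq: "U * diag_quat n m d * quat_adjoint V = U' * diag_quat n m d' * quat_adjoint V'"
  shows "(\<Sum>i<min n m. f ((d i)\<^sup>2)) = (\<Sum>i<min n m. f ((d' i)\<^sup>2))"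
proof -
  define D where "D = diag_quat n m d"
  define D' where "D' = diag_quat n m d'"
  define W where "W = quat_adjoint U' * U"
  define Z where "Z = quat_adjoint V' * V"
  have D: "D \<in> carrier_mat n m" "D' \<in> carrier_mat n m"
    by (simp_all add: D_def D'_def diag_quat_carrier)
  note c = quat_unitaryD(1,2)[OF U] quat_unitaryD(1,2)[OF V]
    quat_unitaryD(1,2)[OF U'] quat_unitaryD(1,2)[OF V']
  have W: "quat_unitary n W" and Z: "quat_unitary m Z"
    by (simp_all add: W_def Z_def quat_unitary_mult quat_unitary_adjoint U U' V V')
  note cW = quat_unitaryD(1,2)[OF W] quat_unitaryD(1,2)[OF Z]
  have eq': "U * D * quat_adjoint V = U' * D' * quat_adjoint V'"
    using eq by (simp add: D_def D'_def)
  have UD: "U * D = U' * D' * Z"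
  proof -
    have "U * D = U * D * quat_adjoint V * V"
      using quat_unitary_cancel(4)[OF V, of "U * D" n] c D by simp
    also have "\<dots> = U' * D' * quat_adjoint V' * V" by (simp only: eq')
    also have "\<dots> = U' * D' * Z"
      unfolding Z_def using c D by (intro assoc_mult_mat[of _ n m _ m _ m]) auto
    finally show ?thesis .
  qed
  have U'D': "U' * D' = U * D * quat_adjoint Z"
    using UD c cW D quat_unitary_cancel(3)[OF Z, of "U' * D'" n] by simp
  have WD: "W * D = D' * Z"
  proof -
    have "W * D = quat_adjoint U' * (U' * (D' * Z))"
      using UD c cW D by (simp add: W_def assoc_mult_mat[of _ n n _ n _ m] assoc_mult_mat[of _ n n _ m _ m])
    then show ?thesis using quat_unitary_cancel(1)[OF U', of "D' * Z" m] D cW by simp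
  qed
  have WD': "quat_adjoint W * D' = D * quat_adjoint Z"
  proof -
    have "quat_adjoint W * D' = quat_adjoint U * (U * (D * quat_adjoint Z))"
      using U'D' c cW D by (simp add: W_def quat_adjoint_mult[of _ n n _ n] quat_adjoint_adjoint
        assoc_mult_mat[of _ n n _ n _ m] assoc_mult_mat[of _ n n _ m _ m])
    then show ?thesis using quat_unitary_cancel(1)[OF U, of "D * quat_adjoint Z" m] D cW by simp
  qed
  have e1: "(if j < n then d j *\<^sub>R W $$ (i, j) else 0) = (if i < m then d' i *\<^sub>R Z $$ (i, j) else 0)"
    if "i < n" "j < m" for i j
    using arg_cong[OF WD, of "\<lambda>A. A $$ (i, j)"] that cW
    by (simp add: D_def D'_def mult_diag_quat_index[of _ n n] diag_quat_mult_index[of _ m m]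
      del: index_mult_mat index_map_mat)
  have e2: "(if j < n then d' j *\<^sub>R W $$ (j, i) else 0) = (if i < m then d i *\<^sub>R Z $$ (j, i) else 0)"
    if "i < n" "j < m" for i j
  proof -
    have "(if j < n then d' j *\<^sub>R conjugate (W $$ (j, i)) else 0)
        = (if i < m then d i *\<^sub>R conjugate (Z $$ (j, i)) else 0)"
      using arg_cong[OF WD', of "\<lambda>A. A $$ (i, j)"] that cW
      by (simp add: D_def D'_def mult_diag_quat_index[of _ n n] diag_quat_mult_index[of _ m m]
        quat_adjoint_index[of _ n n] quat_adjoint_index[of _ m m]
        del: index_mult_mat index_map_mat split: if_splits)
    then show ?thesis
      by (subst conjugate_cancel_iff[symmetric])
        (simp only: conjugate_quat_scaleR conjugate_quat_zero if_distrib[of conjugate])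
  qed
  \<comment> \<open>The diagonals of \<open>D D\<^sup>*\<close> and \<open>D' D'\<^sup>*\<close>, the eigenvalues of \<open>X X\<^sup>*\<close>.\<close>
  define e where "e = (\<lambda>i. if i < m then (d i)\<^sup>2 else 0)"
  define e' where "e' = (\<lambda>i. if i < m then (d' i)\<^sup>2 else 0)"
  have key: "(norm (W $$ (i, j)))\<^sup>2 * f (e' i) = (norm (W $$ (i, j)))\<^sup>2 * f (e j)"
    if ij: "i < n" "j < n" for i j
  proof -
    have "e' i *\<^sub>R W $$ (i, j) = e j *\<^sub>R W $$ (i, j)"
    proof (cases "i < m")
      case True
      then have a: "d' i *\<^sub>R W $$ (i, j) = (if j < m then d j *\<^sub>R Z $$ (i, j) else 0)"
        using e2[of j i] ij by simp
      have "e' i *\<^sub>R W $$ (i, j) = d' i *\<^sub>R (d' i *\<^sub>R W $$ (i, j))"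
        using True by (simp add: e'_def power2_eq_square)
      also have "\<dots> = (if j < m then d j *\<^sub>R (d' i *\<^sub>R Z $$ (i, j)) else 0)"
        unfolding a by (simp add: mult.commute)
      also have "\<dots> = e j *\<^sub>R W $$ (i, j)"
        using e1[of i j] ij True by (simp add: e_def power2_eq_square flip: scaleR_scaleR)
      finally show ?thesis .
    next
      case False
      then show ?thesis using e1[of i j] ij by (auto simp: e'_def e_def)
    qed
    then have "e' i = e j \<or> W $$ (i, j) = 0" by simp
    then show ?thesis by auto
  qed
  have "(\<Sum>i<n. f (e' i)) = (\<Sum>i<n. \<Sum>j<n. (norm (W $$ (i, j)))\<^sup>2 * f (e' i))"
    by (simp add: sum_distrib_right[symmetric] quat_unitary_row_norm[OF W])
  also have "\<dots> = (\<Sum>i<n. \<Sum>j<n. (norm (W $$ (i, j)))\<^sup>2 * f (e j))"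
    by (simp add: key)
  also have "\<dots> = (\<Sum>j<n. \<Sum>i<n. (norm (W $$ (i, j)))\<^sup>2 * f (e j))"
    by (rule sum.swap)
  also have "\<dots> = (\<Sum>j<n. f (e j))"
    by (simp add: sum_distrib_right[symmetric] quat_unitary_col_norm[OF W])
  finally have sum_e: "(\<Sum>i<n. f (e i)) = (\<Sum>i<n. f (e' i))" by simp
  \<comment> \<open>The padding contributes \<open>f 0\<close> equally often on both sides and cancels.\<close>
  have split: "(\<Sum>i<n. f (if i < m then g i else 0))
      = (\<Sum>i<min n m. f (g i)) + (\<Sum>i\<in>{min n m..<n}. f 0)" for g :: "nat \<Rightarrow> real"
  proof -
    have "{..<n} = {..<min n m} \<union> {min n m..<n}" by auto
    then have "(\<Sum>i<n. f (if i < m then g i else 0))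
      = (\<Sum>i<min n m. f (if i < m then g i else 0)) + (\<Sum>i\<in>{min n m..<n}. f (if i < m then g i else 0))"
      by (simp add: sum.union_disjoint ivl_disj_int)
    also have "(\<Sum>i\<in>{min n m..<n}. f (if i < m then g i else 0)) = (\<Sum>i\<in>{min n m..<n}. f 0)"
      by (intro sum.cong) auto
    finally show ?thesis by simp
  qed
  show ?thesis using sum_e unfolding e_def e'_def split by simp
qed

text \<open>If \<open>t i < s i\<close>, then at level \<open>s i\<close> the sequence
  \<open>s\<close> has at least \<open>i + 1\<close> terms and \<open>t\<close> at most \<open>i\<close>. Antitone sequences are
  thus recovered from the sizes of their superlevel sets.\<close>

lemma antitone_le_of_card_ge:
  fixes s t :: "nat \<Rightarrow> real"
  assumes s: "\<And>i j. i \<le> j \<Longrightarrow> j < k \<Longrightarrow> s j \<le> s i"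
    and t: "\<And>i j. i \<le> j \<Longrightarrow> j < k \<Longrightarrow> t j \<le> t i"
    and card: "\<And>v. card {i. i < k \<and> v \<le> s i} = card {i. i < k \<and> v \<le> t i}"
    and i: "i < k"
  shows "s i \<le> t i"
proof (rule ccontr)
  assume less: "\<not> s i \<le> t i"
  have "j < i" if "j < k" "s i \<le> t j" for j
    using t[of i j] that less by (meson leI order_trans)
  then have "{j. j < k \<and> s i \<le> t j} \<subseteq> {..<i}" by auto
  then have "card {j. j < k \<and> s i \<le> t j} \<le> i"
    using card_mono[of "{..<i}"] by fastforce
  moreover have "{..i} \<subseteq> {j. j < k \<and> s i \<le> s j}" using s i by auto
  then have "Suc i \<le> card {j. j < k \<and> s i \<le> s j}"
    using card_mono[of "{j. j < k \<and> s i \<le> s j}" "{..i}"] by simp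
  ultimately show False using card[of "s i"] by simp
qed

lemma diagonal_mat_eq_rect_diag:
  "S \<in> carrier_mat n m \<Longrightarrow> diagonal_mat S \<Longrightarrow> S = rect_diag n m (\<lambda>i. S $$ (i, i))"
  by (rule eq_matI) (auto simp: rect_diag_def diagonal_mat_def)

lemma is_qsvdD:
  assumes "is_qsvd X U S V" "X \<in> carrier_mat n m"
  shows "quat_unitary n U" "quat_unitary m V" "S = rect_diag n m (\<lambda>i. S $$ (i, i))"
    "\<And>i. i < min n m \<Longrightarrow> 0 \<le> S $$ (i, i)"
    "\<And>i j. i \<le> j \<Longrightarrow> j < min n m \<Longrightarrow> S $$ (j, j) \<le> S $$ (i, i)"
    "X = U * diag_quat n m (\<lambda>i. S $$ (i, i)) * quat_adjoint V"
proof -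
  have dim: "dim_row X = n" "dim_col X = m" using assms(2) by auto
  note q = assms(1)[unfolded is_qsvd_def dim]
  show "quat_unitary n U" "quat_unitary m V"
    "\<And>i. i < min n m \<Longrightarrow> 0 \<le> S $$ (i, i)"
    "\<And>i j. i \<le> j \<Longrightarrow> j < min n m \<Longrightarrow> S $$ (j, j) \<le> S $$ (i, i)"
    using q by blast+
  show S: "S = rect_diag n m (\<lambda>i. S $$ (i, i))"
    using q by (intro diagonal_mat_eq_rect_diag) blast+
  show "X = U * diag_quat n m (\<lambda>i. S $$ (i, i)) * quat_adjoint V"
    unfolding S[symmetric] using q by blast
qed

text \<open>The size of a superlevel set of the diagonal is the sum of an indicator function over it,
  so it is the same for both decompositions by the invariance above.\<close>

lemma is_qsvd_unique:
  assumes "is_qsvd X U S V" "is_qsvd X U' S' V'"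
  shows "S = S'"
proof -
  define n where "n = dim_row X"
  define m where "m = dim_col X"
  define s where "s = (\<lambda>i. S $$ (i, i))"
  define s' where "s' = (\<lambda>i. S' $$ (i, i))"
  have X: "X \<in> carrier_mat n m" unfolding n_def m_def by (rule carrier_matI; rule refl)
  note q = is_qsvdD[OF assms(1) X, folded s_def] and q' = is_qsvdD[OF assms(2) X, folded s'_def]
  note S = q(3) and S' = q'(3)
  have ant: "\<And>i j. i \<le> j \<Longrightarrow> j < min n m \<Longrightarrow> s j \<le> s i"
    "\<And>i j. i \<le> j \<Longrightarrow> j < min n m \<Longrightarrow> s' j \<le> s' i"
    and nonneg: "\<And>i. i < min n m \<Longrightarrow> 0 \<le> s i" "\<And>i. i < min n m \<Longrightarrow> 0 \<le> s' i"
    using q(4,5) q'(4,5) unfolding s_def s'_def by blast+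
  have sums: "(\<Sum>i<min n m. f ((s i)\<^sup>2)) = (\<Sum>i<min n m. f ((s' i)\<^sup>2))" for f :: "real \<Rightarrow> real"
    by (rule real_diag_invariant[OF q(1,2) q'(1,2) trans[OF q(6)[symmetric] q'(6)]])
  have card: "card {i. i < min n m \<and> v \<le> s i} = card {i. i < min n m \<and> v \<le> s' i}" for v
  proof -
    have *: "real (card {i. i < min n m \<and> v \<le> t i}) = (\<Sum>i<min n m. of_bool (v \<le> sqrt ((t i)\<^sup>2)))"
      if "\<And>i. i < min n m \<Longrightarrow> 0 \<le> t i" for t
    proof -
      have "(\<Sum>i<min n m. of_bool (v \<le> sqrt ((t i)\<^sup>2))) = (\<Sum>i<min n m. of_bool (v \<le> t i) :: real)"
        using that by (intro sum.cong) auto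
      also have "\<dots> = real (card ({..<min n m} \<inter> {i. v \<le> t i}))" by simp
      also have "{..<min n m} \<inter> {i. v \<le> t i} = {i. i < min n m \<and> v \<le> t i}" by auto
      finally show ?thesis by simp
    qed
    have "real (card {i. i < min n m \<and> v \<le> s i}) = real (card {i. i < min n m \<and> v \<le> s' i})"
      using *[of s] *[of s'] nonneg sums[of "\<lambda>x. of_bool (v \<le> sqrt x)"] by presburger
    then show ?thesis by simp
  qed
  have "s i = s' i" if "i < min n m" for i
    using antitone_le_of_card_ge[OF ant card that] antitone_le_of_card_ge[OF ant(2,1) card[symmetric] that]
    by (rule antisym)
  then show ?thesis unfolding S S' rect_diag_def by (intro cong_mat) auto
qed

text \<open>This discharges the definite description in the definition of \<^const>\<open>sing_val\<close>:
  any decomposition may be used to compute the singular values.\<close>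

lemma sing_val_eq: "is_qsvd X U S V \<Longrightarrow> sing_val X i = S $$ (i, i)"
  unfolding sing_val_def
  by (rule arg_cong[where f = "\<lambda>S. S $$ (i, i)"], rule the_equality) (blast intro: is_qsvd_unique)+

section \<open>Bounding the inner product of two matrices\<close>

lemma qRe_le_norm: "qRe x \<le> norm x"
  using norm_cauchy_schwarz[of x 1] by (simp add: inner_quat_def)

text \<open>The left-hand side is the sum of
  \<open>t i * s j * Re (w i j * z j i)\<close>, and the arithmetic-geometric mean inequality bounds the
  modulus of \<open>w i j * z j i\<close> by the mean of the two squared moduli. As \<open>W\<close> and
  \<open>Z\<close> are unitary, these means have row and column sums at most one. Sums can be smaller than one
  because only the leading square block is used.\<close>

lemma mat_inner_diag_le_doubly_substochastic:
  fixes s t :: "nat \<Rightarrow> real"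
  assumes W: "quat_unitary n W" and Z: "quat_unitary m Z"
    and s: "\<And>i. i < min n m \<Longrightarrow> 0 \<le> s i" and t: "\<And>i. i < min n m \<Longrightarrow> 0 \<le> t i"
  shows "\<exists>M. (\<forall>i<min n m. \<forall>j<min n m. 0 \<le> M i j) \<and>
    (\<forall>i<min n m. (\<Sum>j<min n m. M i j) \<le> 1) \<and>
    (\<forall>j<min n m. (\<Sum>i<min n m. M i j) \<le> 1) \<and>
    mat_inner (diag_quat n m t) (W * diag_quat n m s * Z)
      \<le> (\<Sum>i<min n m. \<Sum>j<min n m. M i j * (t i * s j))"
proof -
  let ?k = "min n m"
  define M where "M = (\<lambda>i j. ((norm (W $$ (i, j)))\<^sup>2 + (norm (Z $$ (j, i)))\<^sup>2) / 2)"
  note c = quat_unitaryD(1)[OF W] quat_unitaryD(1)[OF Z]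
  have M_nonneg: "0 \<le> M i j" for i j by (simp add: M_def)
  have part: "(\<Sum>j<?k. g j) \<le> 1" if "(\<Sum>j<l. g j) = 1" "?k \<le> l" "\<And>j. 0 \<le> g j" for g :: "nat \<Rightarrow> real" and l
    using sum_mono2[of "{..<l}" "{..<?k}" g] that by auto
  have M_row: "(\<Sum>j<?k. M i j) \<le> 1" if "i < ?k" for i
    using part[OF quat_unitary_row_norm[OF W, of i]] part[OF quat_unitary_col_norm[OF Z, of i]] that
    by (simp add: M_def sum.distrib sum_divide_distrib[symmetric])
  have M_col: "(\<Sum>i<?k. M i j) \<le> 1" if "j < ?k" for j
    using part[OF quat_unitary_col_norm[OF W, of j]] part[OF quat_unitary_row_norm[OF Z, of j]] that
    by (simp add: M_def sum.distrib sum_divide_distrib[symmetric])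
  have entry: "qRe ((W * diag_quat n m s * Z) $$ (i, i)) \<le> (\<Sum>j<?k. M i j * s j)" if i: "i < ?k" for i
  proof -
    have c': "W * diag_quat n m s \<in> carrier_mat n m"
      using c by simp
    have "(W * diag_quat n m s * Z) $$ (i, i) = (\<Sum>j<m. (W * diag_quat n m s) $$ (i, j) * Z $$ (j, i))"
      using i by (intro mult_mat_index[OF c' c(2)]) auto
    also have "\<dots> = (\<Sum>j<m. if j < n then s j *\<^sub>R (W $$ (i, j) * Z $$ (j, i)) else 0)"
      using i c by (intro sum.cong) (auto simp: mult_diag_quat_index[of _ n n] simp del: index_mult_mat)
    also have "\<dots> = (\<Sum>j\<in>{..<m} \<inter> {j. j < n}. s j *\<^sub>R (W $$ (i, j) * Z $$ (j, i)))"
      by (simp add: sum.inter_restrict)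
    also have "{..<m} \<inter> {j. j < n} = {..<?k}" by auto
    finally have "qRe ((W * diag_quat n m s * Z) $$ (i, i))
        \<le> norm (\<Sum>j<?k. s j *\<^sub>R (W $$ (i, j) * Z $$ (j, i)))"
      using qRe_le_norm by metis
    also have "\<dots> \<le> (\<Sum>j<?k. M i j * s j)"
    proof (rule sum_norm_le)
      fix j assume "j \<in> {..<?k}"
      then have "0 \<le> s j" using s by simp
      moreover have "norm (W $$ (i, j)) * norm (Z $$ (j, i)) \<le> M i j"
        using sum_squares_bound[of "norm (W $$ (i, j))" "norm (Z $$ (j, i))"] by (simp add: M_def)
      ultimately show "norm (s j *\<^sub>R (W $$ (i, j) * Z $$ (j, i))) \<le> M i j * s j"
        by (simp add: norm_quat_mult mult.commute[of "M i j"] mult_left_mono)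
    qed
    finally show ?thesis .
  qed
  have "mat_inner (diag_quat n m t) (W * diag_quat n m s * Z) \<le> (\<Sum>i<?k. t i * (\<Sum>j<?k. M i j * s j))"
    unfolding mat_inner_diag_quat using entry t by (intro sum_mono mult_left_mono) auto
  also have "\<dots> = (\<Sum>i<?k. \<Sum>j<?k. M i j * (t i * s j))"
    by (simp add: sum_distrib_left mult.left_commute)
  finally show ?thesis using M_nonneg M_row M_col by (intro exI[of _ M]) simp
qed

section \<open>Compactness of the unitary group\<close>

text \<open>The compact set is the image of a four-dimensional real box under
  the real-linear parametrization of the quaternions by their components.\<close>

lemma quat_unit_ball_subset_compact: "\<exists>B. compact B \<and> (\<forall>x::quat. norm x \<le> 1 \<longrightarrow> x \<in> B)"
proof -
  define h where "h = (\<lambda>(a, b, c, d). a *\<^sub>R Quat 1 0 0 0 + b *\<^sub>R Quat 0 1 0 0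
    + c *\<^sub>R Quat 0 0 1 0 + d *\<^sub>R Quat 0 0 0 1)"
  define K :: "(real \<times> real \<times> real \<times> real) set" where "K = {-1..1} \<times> {-1..1} \<times> {-1..1} \<times> {-1..1}"
  have "continuous_on K h"
    unfolding h_def case_prod_beta by (intro continuous_intros)
  moreover have "compact K" unfolding K_def by (intro compact_Times compact_Icc)
  ultimately have "compact (h ` K)" by (rule compact_continuous_image)
  moreover have "x \<in> h ` K" if "norm x \<le> 1" for x :: quat
  proof -
    have "(qRe x)\<^sup>2 + (qIm1 x)\<^sup>2 + (qIm2 x)\<^sup>2 + (qIm3 x)\<^sup>2 \<le> 1"
      using that by (simp add: norm_quat_eq)
    then have "(qRe x)\<^sup>2 \<le> 1" "(qIm1 x)\<^sup>2 \<le> 1" "(qIm2 x)\<^sup>2 \<le> 1" "(qIm3 x)\<^sup>2 \<le> 1"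
      by (smt (verit) zero_le_power2)+
    then have "(qRe x, qIm1 x, qIm2 x, qIm3 x) \<in> K"
      by (simp add: K_def abs_square_le_1 abs_le_iff)
    moreover have "x = h (qRe x, qIm1 x, qIm2 x, qIm3 x)"
      by (simp add: h_def quat_eq_iff)
    ultimately show ?thesis by blast
  qed
  ultimately show ?thesis by blast
qed

lemma continuous_on_conjugate_quat [continuous_intros]:
  "continuous_on A f \<Longrightarrow> continuous_on A (\<lambda>x. conjugate (f x :: quat))"
proof -
  have "bounded_linear (conjugate :: quat \<Rightarrow> quat)"
    by (rule bounded_linear_intro[of _ 1])
      (simp_all add: conjugate_quat_add conjugate_quat_scaleR norm_conjugate_quat)
  then show "continuous_on A f \<Longrightarrow> continuous_on A (\<lambda>x. conjugate (f x :: quat))"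
    by (rule bounded_linear.continuous_on)
qed

text \<open>Unitarity of a matrix given by its entry function is a finite system of
  polynomial equations in the entries, hence a closed condition in the product topology.\<close>

lemma quat_unitary_mat_iff:
  "quat_unitary n (mat n n u) \<longleftrightarrow> (\<forall>i<n. \<forall>j<n.
    (\<Sum>k<n. u (i, k) * conjugate (u (j, k))) = of_bool (i = j) \<and>
    (\<Sum>k<n. conjugate (u (k, i)) * u (k, j)) = of_bool (i = j))"
proof -
  have c: "mat n n u \<in> carrier_mat n n" "quat_adjoint (mat n n u) \<in> carrier_mat n n"
    by (simp_all add: quat_adjoint_carrier)
  have iff: "A * B = 1\<^sub>m n \<longleftrightarrow> (\<forall>i<n. \<forall>j<n. (\<Sum>k<n. A $$ (i, k) * B $$ (k, j)) = of_bool (i = j))"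
    if "A \<in> carrier_mat n n" "B \<in> carrier_mat n n" for A B :: "quat mat"
    using that unfolding mat_eq_iff
    by (auto simp: mult_mat_index[of _ n n _ n] simp del: index_mult_mat(1))
  show ?thesis
    unfolding quat_unitary_def iff[OF c] iff[OF c(2,1)]
    by (auto simp: quat_adjoint_index[OF c(1)])
qed

lemma quat_unitary_entry_le_1:
  assumes "quat_unitary n U" "i < n" "j < n"
  shows "norm (U $$ (i, j)) \<le> 1"
proof -
  have "(norm (U $$ (i, j)))\<^sup>2 \<le> (\<Sum>j<n. (norm (U $$ (i, j)))\<^sup>2)"
    using assms(3) by (intro member_le_sum) auto
  then show ?thesis
    using quat_unitary_row_norm[OF assms(1,2)] by (simp add: abs_square_le_1)
qed

text \<open>The unitary group is represented by a set of entry functions, which is compact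
  in the product topology: unitarity is a closed condition that bounds the entries by one, and
  Tychonoff's theorem applies once the coordinates outside the \<open>n\<close> by \<open>n\<close> block are
  confined to a compact set as well.\<close>

lemma compact_unitary:
  obtains K :: "(nat \<times> nat \<Rightarrow> quat) set" where "compact K"
    "\<And>u. u \<in> K \<Longrightarrow> quat_unitary n (mat n n u)"
    "\<And>U. quat_unitary n U \<Longrightarrow> \<exists>u\<in>K. mat n n u = U"
proof -
  obtain B :: "quat set" where B: "compact B" "\<And>x. norm x \<le> 1 \<Longrightarrow> x \<in> B"
    using quat_unit_ball_subset_compact by blast
  define K where "K = PiE UNIV (\<lambda>_::nat\<times>nat. B) \<inter> {u. quat_unitary n (mat n n u)}"
  have "compact (PiE UNIV (\<lambda>_::nat\<times>nat. B))"
    using B(1) compactin_PiE[of "\<lambda>_. euclidean" "UNIV :: (nat \<times> nat) set" "\<lambda>_. B"]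
    by (simp add: euclidean_product_topology)
  moreover have "closed {u. quat_unitary n (mat n n u)}"
  proof -
    have c: "continuous_on UNIV (\<lambda>u. \<Sum>k<n. u (i, k) * conjugate (u (j, k)) :: quat)"
      "continuous_on UNIV (\<lambda>u. \<Sum>k<n. conjugate (u (k, i)) * u (k, j) :: quat)" for i j :: nat
      by (intro continuous_on_sum continuous_on_mult continuous_on_conjugate_quat
        continuous_on_product_coordinates)+
    have "{u. quat_unitary n (mat n n u)} = (\<Inter>i\<in>{..<n}. \<Inter>j\<in>{..<n}.
        {u. (\<Sum>k<n. u (i, k) * conjugate (u (j, k))) = of_bool (i = j)} \<inter>
        {u. (\<Sum>k<n. conjugate (u (k, i)) * u (k, j)) = of_bool (i = j)})"
      unfolding quat_unitary_mat_iff by auto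
    also have "closed \<dots>"
      by (intro closed_INT closed_Int ballI closed_Collect_eq c continuous_on_const)
    finally show ?thesis .
  qed
  ultimately have "compact K" unfolding K_def by (rule compact_Int_closed)
  moreover have "\<exists>u\<in>K. mat n n u = U" if U: "quat_unitary n U" for U
  proof -
    define u where "u = (\<lambda>(i, j). if i < n \<and> j < n then U $$ (i, j) else 0)"
    have "mat n n u = U"
      using quat_unitaryD(1)[OF U] by (intro eq_matI) (auto simp: u_def)
    moreover have "u p \<in> B" for p
      using quat_unitary_entry_le_1[OF U] B(2) by (auto simp: u_def split: prod.split)
    ultimately show ?thesis using U by (intro bexI[of _ u]) (auto simp: K_def)
  qed
  moreover have "quat_unitary n (mat n n u)" if "u \<in> K" for u
    using that unfolding K_def by blast
  ultimately show ?thesis using that[of K] by blast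
qed

lemma mat_inner_unitary_attains_max:
  assumes A: "A \<in> carrier_mat n m" and X: "X \<in> carrier_mat n m"
  obtains U V where "quat_unitary n U" "quat_unitary m V"
    "\<And>U' V'. quat_unitary n U' \<Longrightarrow> quat_unitary m V' \<Longrightarrow>
      mat_inner (U' * A * quat_adjoint V') X \<le> mat_inner (U * A * quat_adjoint V) X"
proof -
  obtain K :: "(nat \<times> nat \<Rightarrow> quat) set" where K: "compact K"
    "\<And>u. u \<in> K \<Longrightarrow> quat_unitary n (mat n n u)"
    "\<And>U. quat_unitary n U \<Longrightarrow> \<exists>u\<in>K. mat n n u = U"
    using compact_unitary[of n] by blast
  obtain L :: "(nat \<times> nat \<Rightarrow> quat) set" where L: "compact L"
    "\<And>u. u \<in> L \<Longrightarrow> quat_unitary m (mat m m u)"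
    "\<And>U. quat_unitary m U \<Longrightarrow> \<exists>u\<in>L. mat m m u = U"
    using compact_unitary[of m] by blast
  define g where "g = (\<lambda>(u, v). mat_inner (mat n n u * A * quat_adjoint (mat m m v)) X)"
  have "g = (\<lambda>p. \<Sum>i<n. \<Sum>j<m. inner (\<Sum>l<m. (\<Sum>k<n. fst p (i, k) * A $$ (k, l)) *
      conjugate (snd p (j, l))) (X $$ (i, j)))"
  proof
    fix p :: "(nat \<times> nat \<Rightarrow> quat) \<times> (nat \<times> nat \<Rightarrow> quat)"
    obtain u v where p: "p = (u, v)" by (cases p)
    have c: "mat n n u \<in> carrier_mat n n" "mat m m v \<in> carrier_mat m m" by auto
    have c': "quat_adjoint (mat m m v) \<in> carrier_mat m m" "mat n n u * A \<in> carrier_mat n m"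
      using quat_adjoint_carrier[OF c(2)] mult_carrier_mat[OF c(1) A] .
    show "g p = (\<Sum>i<n. \<Sum>j<m. inner (\<Sum>l<m. (\<Sum>k<n. fst p (i, k) * A $$ (k, l)) *
      conjugate (snd p (j, l))) (X $$ (i, j)))"
      unfolding p g_def prod.case mat_inner_carrier[OF mult_carrier_mat[OF c'(2,1)]]
      by (intro sum.cong refl)
        (simp add: mult_mat_index[OF c'(2,1)] mult_mat_index[OF c(1) A]
          quat_adjoint_index[OF c(2)] del: index_mult_mat(1))
  qed
  moreover have coord: "continuous_on S (\<lambda>p. fst p i)" "continuous_on S (\<lambda>p. snd p i)"
    for S :: "((nat \<times> nat \<Rightarrow> quat) \<times> (nat \<times> nat \<Rightarrow> quat)) set" and i :: "nat \<times> nat"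
    by (rule continuous_on_product_then_coordinatewise[OF continuous_on_fst[OF continuous_on_id]]
      continuous_on_product_then_coordinatewise[OF continuous_on_snd[OF continuous_on_id]])+
  ultimately have "continuous_on (K \<times> L) g"
    by (simp only:) (intro continuous_on_sum continuous_on_inner continuous_on_mult
      continuous_on_conjugate_quat continuous_on_const coord)
  moreover have "compact (K \<times> L)" "K \<times> L \<noteq> {}"
    using compact_Times[OF K(1) L(1)] K(3)[OF quat_unitary_one] L(3)[OF quat_unitary_one] by auto
  ultimately obtain p where p: "p \<in> K \<times> L" "\<forall>q\<in>K \<times> L. g q \<le> g p"
    using continuous_attains_sup by blast
  obtain u v where uv: "p = (u, v)" by (cases p)
  show ?thesis
  proof (rule that[of "mat n n u" "mat m m v"])
    show "quat_unitary n (mat n n u)" "quat_unitary m (mat m m v)"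
      using p uv K L by auto
    fix U' V' assume "quat_unitary n U'" "quat_unitary m V'"
    then obtain u' v' where "u' \<in> K" "mat n n u' = U'" "v' \<in> L" "mat m m v' = V'"
      using K L by blast
    then show "mat_inner (U' * A * quat_adjoint V') X
      \<le> mat_inner (mat n n u * A * quat_adjoint (mat m m v)) X"
      using p(2) uv by (force simp: g_def)
  qed
qed

section \<open>Optimality over the unitary group\<close>

text \<open>The matrix \<open>1 - w r w\<^sup>*\<close>. For a unit vector \<open>w\<close> and
  \<open>r = 1 - \<omega>\<close> with \<open>\<omega>\<close> a unit quaternion it multiplies the coordinate along
  \<open>w\<close> by \<open>\<omega>\<close> and fixes the orthogonal complement of \<open>w\<close>.\<close>

definition quat_reflection :: "nat \<Rightarrow> (nat \<Rightarrow> quat) \<Rightarrow> quat \<Rightarrow> quat mat" where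
  "quat_reflection n w r = mat n n (\<lambda>(i, j). of_bool (i = j) - w i * r * conjugate (w j))"

text \<open>The condition on \<open>r\<close> and \<open>r'\<close> says that \<open>(1 - r) * (1 - r') = 1\<close>: the two
  matrices act by inverse factors along \<open>w\<close>.\<close>

lemma quat_reflection_mult:
  assumes w: "(\<Sum>k<n. (norm (w k))\<^sup>2) = 1" and r: "r * r' = r + r'"
  shows "quat_reflection n w r * quat_reflection n w r' = 1\<^sub>m n"
proof (rule eq_matI)
  have c: "quat_reflection n w r \<in> carrier_mat n n" for r
    by (simp add: quat_reflection_def)
  fix i j assume "i < dim_row (1\<^sub>m n :: quat mat)" "j < dim_col (1\<^sub>m n :: quat mat)"
  then have ij: "i < n" "j < n" by auto
  have ww: "(\<Sum>k<n. conjugate (w k) * w k) = 1"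
  proof -
    have "(\<Sum>k<n. conjugate (w k) * w k) = of_real (\<Sum>k<n. (norm (w k))\<^sup>2)"
      unfolding of_real_sum quat_conjugate_mult_self ..
    then show ?thesis by (simp only: w of_real_1)
  qed
  have "(quat_reflection n w r * quat_reflection n w r') $$ (i, j)
    = (\<Sum>k<n. (of_bool (i = k) - w i * r * conjugate (w k)) * (of_bool (k = j) - w k * r' * conjugate (w j)))"
    unfolding mult_mat_index[OF c c ij] using ij by (intro sum.cong) (auto simp: quat_reflection_def)
  also have "\<dots> = (\<Sum>k<n. (if k = i then of_bool (k = j) - w k * r' * conjugate (w j) else 0)
      - (if k = j then w i * r * conjugate (w k) else 0)
      + w i * r * (conjugate (w k) * w k) * (r' * conjugate (w j)))"
    by (intro sum.cong) (auto simp: algebra_simps)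
  also have "\<dots> = of_bool (i = j) - w i * r' * conjugate (w j) - w i * r * conjugate (w j)
      + w i * r * (\<Sum>k<n. conjugate (w k) * w k) * (r' * conjugate (w j))"
    using ij by (simp add: sum.distrib sum_subtractf sum_distrib_left sum_distrib_right)
  also have "\<dots> = of_bool (i = j) + w i * (r * r' - r - r') * conjugate (w j)"
    by (simp add: ww algebra_simps)
  finally show "(quat_reflection n w r * quat_reflection n w r') $$ (i, j) = 1\<^sub>m n $$ (i, j)"
    using ij r by simp
qed (simp_all add: quat_reflection_def)

lemma quat_unitary_reflection:
  assumes w: "(\<Sum>k<n. (norm (w k))\<^sup>2) = 1" and \<omega>: "norm \<omega> = 1"
  shows "quat_unitary n (quat_reflection n w (1 - \<omega>))"
proof -
  have adj: "quat_adjoint (quat_reflection n w r) = quat_reflection n w (conjugate r)" for r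
    by (rule eq_matI)
      (auto simp: quat_adjoint_def quat_reflection_def conjugate_quat_mult conjugate_quat_zero
        quat_eq_iff algebra_simps)
  have conj: "conjugate (1 - \<omega>) = 1 - conjugate \<omega>"
    by (simp add: quat_eq_iff)
  have "\<omega> * conjugate \<omega> = 1" "conjugate \<omega> * \<omega> = 1"
    by (simp_all add: quat_mult_conjugate quat_conjugate_mult_self \<omega>)
  then have "(1 - \<omega>) * (1 - conjugate \<omega>) = (1 - \<omega>) + (1 - conjugate \<omega>)"
    "(1 - conjugate \<omega>) * (1 - \<omega>) = (1 - conjugate \<omega>) + (1 - \<omega>)"
    by (simp_all add: algebra_simps)
  then show ?thesis
    unfolding quat_unitary_def adj conj
    using quat_reflection_mult[OF w] by (simp add: quat_reflection_def)
qed

text \<open>The quaternion \<open>w\<^sup>* D w\<close>.\<close>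

definition quat_form :: "nat \<Rightarrow> quat mat \<Rightarrow> (nat \<Rightarrow> quat) \<Rightarrow> quat" where
  "quat_form n D w = (\<Sum>i<n. \<Sum>j<n. conjugate (w i) * D $$ (i, j) * w j)"

lemma mat_inner_reflection:
  assumes D: "D \<in> carrier_mat n n"
  shows "mat_inner D (quat_reflection n w r) = mat_inner D (1\<^sub>m n) - inner (quat_form n D w) r"
proof -
  have "inner (quat_form n D w) r = (\<Sum>i<n. \<Sum>j<n. inner (D $$ (i, j)) (w i * r * conjugate (w j)))"
    unfolding quat_form_def inner_sum_left
    by (intro sum.cong refl, subst inner_quat_mult_right)
      (simp only: inner_quat_mult_left conjugate_id mult.assoc)
  moreover have "mat_inner D (quat_reflection n w r)
      = (\<Sum>i<n. \<Sum>j<n. inner (D $$ (i, j)) (1\<^sub>m n $$ (i, j)) - inner (D $$ (i, j)) (w i * r * conjugate (w j)))"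
    unfolding mat_inner_carrier[OF D]
    by (intro sum.cong refl) (auto simp: quat_reflection_def inner_diff_right)
  ultimately show ?thesis
    by (simp add: mat_inner_carrier[OF D] sum_subtractf)
qed

text \<open>Comparing the identity with the reflection of parameter
  \<open>1 - \<omega>\<close> shows that the inner product of \<open>q = w\<^sup>* D w\<close> with \<open>\<omega>\<close> is at most
  the real part of \<open>q\<close>. For \<open>\<omega> = q / |q|\<close> this says that \<open>|q|\<close> is at most the real
  part of \<open>q\<close>, the equality case of the Cauchy-Schwarz inequality.\<close>

lemma quat_form_nonneg_real:
  assumes D: "D \<in> carrier_mat n n"
    and max: "\<And>H. quat_unitary n H \<Longrightarrow> mat_inner D H \<le> mat_inner D (1\<^sub>m n)"
    and w: "(\<Sum>k<n. (norm (w k))\<^sup>2) = 1"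
  shows "quat_form n D w = of_real (norm (quat_form n D w))"
proof (cases "quat_form n D w = 0")
  case False
  define q where "q = quat_form n D w"
  define \<omega> where "\<omega> = q /\<^sub>R norm q"
  have q: "norm q > 0" using False by (simp add: q_def)
  then have \<omega>: "norm \<omega> = 1" by (simp add: \<omega>_def)
  have "0 \<le> inner q (1 - \<omega>)"
    using max[OF quat_unitary_reflection[OF w \<omega>]] by (simp add: mat_inner_reflection[OF D] q_def)
  then have "inner q \<omega> \<le> inner q 1" by (simp add: inner_diff_right)
  moreover have "inner q \<omega> = norm q"
    using q by (simp add: \<omega>_def power2_norm_eq_inner[symmetric] power2_eq_square)
  ultimately have "inner q 1 = norm q * norm (1::quat)"
    using norm_cauchy_schwarz[of q 1] by simp
  then have "norm q *\<^sub>R (1::quat) = norm (1::quat) *\<^sub>R q"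
    by (rule norm_cauchy_schwarz_eq[THEN iffD1])
  then show ?thesis by (simp add: q_def of_real_def)
qed simp

lemma sum_eq_two_terms:
  fixes f :: "nat \<Rightarrow> 'a :: comm_monoid_add"
  assumes "a < n" "b < n" "a \<noteq> b" "\<And>i. i < n \<Longrightarrow> i \<noteq> a \<Longrightarrow> i \<noteq> b \<Longrightarrow> f i = 0"
  shows "(\<Sum>i<n. f i) = f a + f b"
proof -
  have "(\<Sum>i<n. f i) = (\<Sum>i\<in>{a, b}. f i)"
    using assms by (intro sum.mono_neutral_right) auto
  then show ?thesis using assms(3) by simp
qed

text \<open>Polarization of a form with nonnegative real values: the unit vectors
  \<open>e\<^sub>i\<close> give the diagonal, and \<open>(e\<^sub>i + e\<^sub>j \<alpha>) / sqrt 2\<close> shows that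
  \<open>D\<^sub>i\<^sub>j \<alpha> + \<alpha>\<^sup>* D\<^sub>j\<^sub>i\<close> is real. Taking \<open>\<alpha> = 1\<close> yields the relation
  between the imaginary parts of the two entries, and taking \<open>\<alpha>\<close> to be an imaginary unit the
  one between their real parts.\<close>

lemma hermitian_of_unitary_max:
  assumes D: "D \<in> carrier_mat n n"
    and max: "\<And>H. quat_unitary n H \<Longrightarrow> mat_inner D H \<le> mat_inner D (1\<^sub>m n)"
    and i: "i < n"
  shows "0 \<le> qRe (D $$ (i, i))" "j < n \<Longrightarrow> D $$ (i, j) = conjugate (D $$ (j, i))"
proof -
  have real: "qIm1 (quat_form n D w) = 0" "qIm2 (quat_form n D w) = 0" "qIm3 (quat_form n D w) = 0"
    "0 \<le> qRe (quat_form n D w)" if "(\<Sum>k<n. (norm (w k))\<^sup>2) = 1" for w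
    by (subst quat_form_nonneg_real[OF D max that]; simp add: of_real_def)+
  have diag: "qIm1 (D $$ (a, a)) = 0" "qIm2 (D $$ (a, a)) = 0" "qIm3 (D $$ (a, a)) = 0"
    "0 \<le> qRe (D $$ (a, a))" if a: "a < n" for a
  proof -
    define w :: "nat \<Rightarrow> quat" where "w = (\<lambda>k. of_bool (k = a))"
    have "(\<Sum>k<n. (norm (w k))\<^sup>2) = (\<Sum>k<n. if k = a then 1 else 0)"
      by (intro sum.cong) (auto simp: w_def)
    then have w: "(\<Sum>k<n. (norm (w k))\<^sup>2) = 1" using a by simp
    have "quat_form n D w = (\<Sum>i<n. if i = a then (\<Sum>j<n. if j = a then D $$ (a, a) else 0) else 0)"
      unfolding quat_form_def
      by (intro sum.cong refl) (auto simp: w_def conjugate_quat_one conjugate_quat_zero intro!: sum.cong)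
    then have "quat_form n D w = D $$ (a, a)" using a by simp
    then show "qIm1 (D $$ (a, a)) = 0" "qIm2 (D $$ (a, a)) = 0" "qIm3 (D $$ (a, a)) = 0"
      "0 \<le> qRe (D $$ (a, a))" using real[OF w] by auto
  qed
  show "0 \<le> qRe (D $$ (i, i))" using diag[OF i] by simp
  assume j: "j < n"
  show "D $$ (i, j) = conjugate (D $$ (j, i))"
  proof (cases "i = j")
    case True
    then show ?thesis using diag[OF i] by (simp add: quat_eq_iff)
  next
    case False
    have off: "qIm1 x = 0 \<and> qIm2 x = 0 \<and> qIm3 x = 0"
      if \<alpha>: "norm \<alpha> = 1" and x: "x = D $$ (i, j) * \<alpha> + conjugate \<alpha> * D $$ (j, i)" for \<alpha> x
    proof -
      \<comment> \<open>Normalizes \<open>e\<^sub>i + e\<^sub>j \<alpha>\<close> to a unit vector.\<close>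
      define c where "c = 1 / sqrt 2"
      have c: "c * c = 1 / 2" by (simp add: c_def)
      define w where "w = (\<lambda>k. if k = i then of_real c else if k = j then c *\<^sub>R \<alpha> else 0)"
      have "(\<Sum>k<n. (norm (w k))\<^sup>2) = 1"
        using \<alpha> False i j c by (subst sum_eq_two_terms[of i n j]) (auto simp: w_def power2_eq_square)
      note r = real[OF this]
      have "quat_form n D w = (\<Sum>j<n. conjugate (w i) * D $$ (i, j) * w j)
          + (\<Sum>k<n. conjugate (w j) * D $$ (j, k) * w k)"
        unfolding quat_form_def
        using False i j by (subst sum_eq_two_terms[of i n j]) (auto simp: w_def conjugate_quat_zero)
      also have "(\<Sum>j<n. conjugate (w i) * D $$ (i, j) * w j)
          = conjugate (w i) * D $$ (i, i) * w i + conjugate (w i) * D $$ (i, j) * w j"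
        using False i j by (subst sum_eq_two_terms[of i n j]) (auto simp: w_def)
      also have "(\<Sum>k<n. conjugate (w j) * D $$ (j, k) * w k)
          = conjugate (w j) * D $$ (j, i) * w i + conjugate (w j) * D $$ (j, j) * w j"
        using False i j by (subst sum_eq_two_terms[of i n j]) (auto simp: w_def)
      also have "conjugate (w i) * D $$ (i, i) * w i = (1 / 2) *\<^sub>R D $$ (i, i)"
        using False c by (simp add: w_def conjugate_quat_of_real scaleR_conv_of_real[symmetric])
          (simp add: of_real_def c)
      also have "conjugate (w i) * D $$ (i, j) * w j = (1 / 2) *\<^sub>R (D $$ (i, j) * \<alpha>)"
        using False c by (simp add: w_def conjugate_quat_of_real scaleR_conv_of_real[symmetric])
      also have "conjugate (w j) * D $$ (j, i) * w i = (1 / 2) *\<^sub>R (conjugate \<alpha> * D $$ (j, i))"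
        using False c by (simp add: w_def conjugate_quat_scaleR) (simp add: of_real_def c)
      also have "conjugate (w j) * D $$ (j, j) * w j = (1 / 2) *\<^sub>R D $$ (j, j)"
      proof -
        have "D $$ (j, j) = qRe (D $$ (j, j)) *\<^sub>R 1"
          using diag[OF j] by (simp add: quat_eq_iff)
        then have "conjugate \<alpha> * D $$ (j, j) * \<alpha> = D $$ (j, j)"
          using \<alpha> by (metis mult_scaleR_left mult_scaleR_right mult_1_right quat_conjugate_mult_self
            of_real_1 one_power2)
        then show ?thesis using False c by (simp add: w_def conjugate_quat_scaleR)
      qed
      finally have "quat_form n D w = (1 / 2) *\<^sub>R (D $$ (i, i) + D $$ (j, j) + x)"
        by (simp add: x scaleR_add_right)
      then show ?thesis using r diag[OF i] diag[OF j] by simp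
    qed
    from off[OF _ refl, of 1] off[OF _ refl, of "Quat 0 1 0 0"] show ?thesis
      by (simp add: quat_eq_iff norm_quat_eq conjugate_quat_one)
  qed
qed

section \<open>Existence of the singular value decomposition\<close>

lemma quat_unitary_permute_columns:
  assumes U: "quat_unitary n U" and \<tau>: "bij_betw \<tau> {..<n} {..<n}"
  shows "quat_unitary n (mat n n (\<lambda>(i, j). U $$ (i, \<tau> j)))"
proof -
  have "quat_unitary n (mat n n (\<lambda>p. U $$ p))"
  proof -
    have "mat n n (\<lambda>p. U $$ p) = U" using quat_unitaryD(1)[OF U] by (intro eq_matI) auto
    then show ?thesis using U by simp
  qed
  then have *: "(\<Sum>k<n. U $$ (i, k) * conjugate (U $$ (j, k))) = of_bool (i = j)"
    "(\<Sum>k<n. conjugate (U $$ (k, i)) * U $$ (k, j)) = of_bool (i = j)" if "i < n" "j < n" for i j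
    using that unfolding quat_unitary_mat_iff by auto
  have \<tau>_less: "\<tau> i < n" if "i < n" for i using bij_betwE[OF \<tau>] that by blast
  have inj: "\<tau> i = \<tau> j \<longleftrightarrow> i = j" if "i < n" "j < n" for i j
    using \<tau> that by (auto simp: bij_betw_def inj_on_def)
  have "(\<Sum>k<n. U $$ (i, \<tau> k) * conjugate (U $$ (j, \<tau> k))) = of_bool (i = j)" if "i < n" "j < n" for i j
    using sum.reindex_bij_betw[OF \<tau>, of "\<lambda>k. U $$ (i, k) * conjugate (U $$ (j, k))"] *(1)[OF that] by simp
  then show ?thesis
    unfolding quat_unitary_mat_iff using *(2)[OF \<tau>_less \<tau>_less] inj by simp
qed

lemma adjoint_mult_permute_columns:
  assumes U: "U \<in> carrier_mat n n" and V: "V \<in> carrier_mat m m" and X: "X \<in> carrier_mat n m"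
    and ij: "i < n" "j < m" "\<sigma> i < n" "\<tau> j < m"
  shows "(quat_adjoint (mat n n (\<lambda>(i, j). U $$ (i, \<sigma> j))) * X * mat m m (\<lambda>(i, j). V $$ (i, \<tau> j))) $$ (i, j)
    = (quat_adjoint U * X * V) $$ (\<sigma> i, \<tau> j)"
proof -
  have entry: "(quat_adjoint U * X * V) $$ (i, j)
      = (\<Sum>l<m. (\<Sum>k<n. conjugate (U $$ (k, i)) * X $$ (k, l)) * V $$ (l, j))"
    if U: "U \<in> carrier_mat n n" and V: "V \<in> carrier_mat m m" and "i < n" "j < m" for U V i j
    using that mult_carrier_mat[OF quat_adjoint_carrier[OF U] X]
    by (simp add: mult_mat_index[OF _ V] mult_mat_index[OF quat_adjoint_carrier[OF U] X]
      quat_adjoint_index[OF U] del: index_mult_mat(1))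
  show ?thesis using ij by (simp add: entry[OF _ _ ij(1,2)] entry[OF U V ij(3,4)] del: index_mult_mat(1))
qed

text \<open>Let \<open>A\<close> be the rectangular diagonal matrix with the strictly decreasing
  weights \<open>k, k - 1, \<dots>, 1\<close>, where \<open>k = min n m\<close>, and let \<open>U, V\<close> maximize the real
  trace pairing of \<open>U A V\<^sup>*\<close> with \<open>X\<close>. Put \<open>B = U\<^sup>* X V\<close>. Varying
  \<open>U\<close> alone makes \<open>B A\<^sup>*\<close> Hermitian with nonnegative diagonal, and varying \<open>V\<close> alone
  makes \<open>B\<^sup>* A\<close> Hermitian. Combined, the two relations multiply an off-diagonal entry of
  \<open>B\<close> by the squares of two different weights with equal results, so it vanishes. The
  diagonal of \<open>B\<close> decreases because exchanging two columns of both \<open>U\<close> and \<open>V\<close>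
  cannot increase the pairing.\<close>

lemma qsvd_exists:
  assumes X: "X \<in> carrier_mat n m"
  obtains U V s where "is_qsvd X U (rect_diag n m s) V"
proof -
  let ?k = "min n m"
  define a where "a = (\<lambda>i. real (?k - i))"
  define A where "A = diag_quat n m a"
  have A: "A \<in> carrier_mat n m" by (simp add: A_def)
  obtain U V where U: "quat_unitary n U" and V: "quat_unitary m V"
    and max: "\<And>U' V'. quat_unitary n U' \<Longrightarrow> quat_unitary m V' \<Longrightarrow>
      mat_inner (U' * A * quat_adjoint V') X \<le> mat_inner (U * A * quat_adjoint V) X"
    using mat_inner_unitary_attains_max[OF A X] by blast
  define B where "B = quat_adjoint U * X * V"
  note c = quat_unitaryD(1,2)[OF U] quat_unitaryD(1,2)[OF V]
  have B: "B \<in> carrier_mat n m" using c X by (simp add: B_def)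
  have max': "mat_inner A (quat_adjoint U' * X * V') \<le> mat_inner A B"
    if "quat_unitary n U'" "quat_unitary m V'" for U' V'
    using max[OF that] that U V A X by (simp add: mat_inner_unitary_conj B_def)
  have left: "mat_inner A (quat_adjoint H * B) \<le> mat_inner A B" if H: "quat_unitary n H" for H
  proof -
    have "quat_adjoint (U * H) * X * V = quat_adjoint H * B"
      using c quat_unitaryD[OF H] X
      by (simp add: B_def quat_adjoint_mult[of _ n n _ n] assoc_mult_mat[of _ n n _ n _ m]
        assoc_mult_mat[of _ n n _ m _ m])
    then show ?thesis using max'[OF quat_unitary_mult[OF U H] V] by simp
  qed
  have right: "mat_inner A (B * H) \<le> mat_inner A B" if H: "quat_unitary m H" for H
  proof -
    have "quat_adjoint U * X * (V * H) = B * H"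
      using c quat_unitaryD[OF H] X
      by (simp add: B_def assoc_mult_mat[of _ n m _ m _ m] assoc_mult_mat[of _ n n _ m _ m])
    then show ?thesis using max'[OF U quat_unitary_mult[OF V H]] by simp
  qed
  define D where "D = B * quat_adjoint A"
  define D' where "D' = quat_adjoint B * A"
  have A': "quat_adjoint A = diag_quat m n a"
    by (rule eq_matI) (auto simp: A_def quat_adjoint_def rect_diag_def conjugate_quat_of_real conjugate_quat_zero)
  have D: "D \<in> carrier_mat n n" and D': "D' \<in> carrier_mat m m"
    unfolding D_def D'_def
    using mult_carrier_mat[OF B quat_adjoint_carrier[OF A]] mult_carrier_mat[OF quat_adjoint_carrier[OF B] A] .
  have D_max: "mat_inner D H \<le> mat_inner D (1\<^sub>m n)" if H: "quat_unitary n H" for H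
  proof -
    have e: "mat_inner D H = mat_inner A (quat_adjoint H * B)" if "quat_unitary n H" for H
    proof -
      note h = quat_unitaryD(1,2)[OF that]
      have "mat_inner D H = mat_inner B (H * A)"
        using mat_inner_mult_right[OF B quat_adjoint_carrier[OF A] h(1)]
        by (simp add: D_def quat_adjoint_adjoint)
      also have "\<dots> = mat_inner (H * A) B"
        using h A B by (intro mat_inner_commute[of _ n m]) auto
      finally show ?thesis using mat_inner_mult_left[OF h(1) A B] by simp
    qed
    show ?thesis using left[OF H] B quat_unitary_cancel(1)[OF quat_unitary_one B]
      by (simp add: e[OF H] e[OF quat_unitary_one])
  qed
  have D'_max: "mat_inner D' H \<le> mat_inner D' (1\<^sub>m m)" if H: "quat_unitary m H" for H
  proof -
    have e: "mat_inner D' H = mat_inner A (B * H)" if "quat_unitary m H" for H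
      using mat_inner_mult_left[OF quat_adjoint_carrier[OF B] A quat_unitaryD(1)[OF that]]
      by (simp add: D'_def quat_adjoint_adjoint)
    show ?thesis using right[OF H] B by (simp add: e[OF H] e[OF quat_unitary_one])
  qed
  have D_ij: "D $$ (i, j) = (if j < m then a j *\<^sub>R B $$ (i, j) else 0)" if "i < n" "j < n" for i j
    unfolding D_def A' using that by (rule mult_diag_quat_index[OF B])
  have D'_ij: "D' $$ (i, j) = (if j < n then a j *\<^sub>R conjugate (B $$ (j, i)) else 0)" if "i < m" "j < m" for i j
    unfolding D'_def A_def mult_diag_quat_index[OF quat_adjoint_carrier[OF B] that]
    using that by (simp add: quat_adjoint_index[OF B])
  \<comment> \<open>The two Hermitian relations, written in terms of the entries of \<open>B\<close>.\<close>
  have D_herm: "(if j < m then a j *\<^sub>R B $$ (i, j) else 0) = (if i < m then a i *\<^sub>R conjugate (B $$ (j, i)) else 0)"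
    if "i < n" "j < n" for i j
    using hermitian_of_unitary_max(2)[OF D D_max that] that
    by (simp only: D_ij if_distrib[of conjugate] conjugate_quat_scaleR conjugate_quat_zero)
  have D'_herm: "(if j < n then a j *\<^sub>R conjugate (B $$ (j, i)) else 0) = (if i < n then a i *\<^sub>R B $$ (i, j) else 0)"
    if "i < m" "j < m" for i j
    using hermitian_of_unitary_max(2)[OF D' D'_max that] that
    by (simp only: D'_ij if_distrib[of conjugate] conjugate_quat_scaleR conjugate_quat_zero conjugate_id)
  have a_pos: "0 < a i" if "i < ?k" for i using that by (simp add: a_def)
  have off: "B $$ (i, j) = 0" if ij: "i < n" "j < m" "i \<noteq> j" for i j
  proof -
    consider "i < m" "j < n" | "i < m" "n \<le> j" | "m \<le> i" "j < n" | "m \<le> i" "n \<le> j"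
      by linarith
    then show ?thesis
    proof cases
      case 1
      \<comment> \<open>Both relations link \<open>B\<close> at \<open>(i, j)\<close> to the conjugate of \<open>B\<close> at \<open>(j, i)\<close>, with the weights swapped; eliminate the latter.\<close>
      have "(a j * a j) *\<^sub>R B $$ (i, j) = (a i * a i) *\<^sub>R B $$ (i, j)"
        using arg_cong[OF D_herm[of i j], of "scaleR (a j)"] arg_cong[OF D'_herm[of i j], of "scaleR (a i)"]
          ij 1 by (simp add: mult.commute)
      then have "a j * a j = a i * a i \<or> B $$ (i, j) = 0" by simp
      moreover have "a j \<noteq> a i" "0 < a i" "0 < a j"
        using ij 1 a_pos[of i] a_pos[of j] by (auto simp: a_def)
      ultimately show ?thesis by (metis square_eq_iff add_pos_pos add.right_inverse less_irrefl)
    next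
      case 2
      then show ?thesis using D'_herm[of i j] ij a_pos[of i] by simp
    next
      case 3
      then show ?thesis using D_herm[of i j] ij a_pos[of j] by simp
    qed (use ij in linarith)
  qed
  define s where "s = (\<lambda>i. qRe (B $$ (i, i)))"
  have diag: "0 \<le> s i" "B $$ (i, i) = of_real (s i)" if i: "i < ?k" for i
  proof -
    have "0 \<le> a i * s i" using hermitian_of_unitary_max(1)[OF D D_max, of i] i
      by (simp add: D_ij s_def)
    then show "0 \<le> s i" using a_pos[OF i] by (simp add: zero_le_mult_iff)
    have "B $$ (i, i) = conjugate (B $$ (i, i))"
      using D_herm[of i i] i a_pos[OF i] by simp
    then show "B $$ (i, i) = of_real (s i)" by (simp add: quat_eq_iff of_real_def s_def)
  qed
  have B_diag: "B = diag_quat n m s"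
    by (rule eq_matI) (use B off diag in \<open>auto simp: rect_diag_def\<close>)
  have sorted: "s j \<le> s i" if ij: "i \<le> j" "j < ?k" for i j
  proof (cases "i = j")
    case False
    \<comment> \<open>Exchanging columns \<open>i\<close> and \<open>j\<close> in both factors permutes the diagonal of \<open>B\<close>.\<close>
    define \<tau> where "\<tau> = Transposition.transpose i j"
    have bij: "bij_betw \<tau> {..<l} {..<l}" if "?k \<le> l" for l
      unfolding \<tau>_def using ij that by (intro permutes_imp_bij permutes_swap_id) auto
    have \<tau>_less: "\<tau> l < ?k" if "l < ?k" for l
      using bij_betwE[OF bij[of ?k]] that by auto
    define U' where "U' = mat n n (\<lambda>(i, j). U $$ (i, \<tau> j))"
    define V' where "V' = mat m m (\<lambda>(i, j). V $$ (i, \<tau> j))"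
    have "quat_unitary n U'" "quat_unitary m V'"
      unfolding U'_def V'_def by (intro quat_unitary_permute_columns U V bij; simp)+
    then have "mat_inner A (quat_adjoint U' * X * V') \<le> mat_inner A B" by (rule max')
    moreover have "(quat_adjoint U' * X * V') $$ (l, l) = B $$ (\<tau> l, \<tau> l)" if "l < ?k" for l
      unfolding U'_def V'_def B_def using that \<tau>_less[OF that]
      by (intro adjoint_mult_permute_columns[OF c(1,3) X]) auto
    ultimately have "(\<Sum>l<?k. a l * s (\<tau> l)) \<le> (\<Sum>l<?k. a l * s l)"
      by (simp add: A_def mat_inner_diag_quat s_def)
    then have "0 \<le> (\<Sum>l<?k. a l * (s l - s (\<tau> l)))"
      by (simp add: right_diff_distrib sum_subtractf)
    also have "\<dots> = a i * (s i - s (\<tau> i)) + a j * (s j - s (\<tau> j))"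
      using ij False by (intro sum_eq_two_terms) (auto simp: \<tau>_def transpose_def)
    also have "\<dots> = (a i - a j) * (s i - s j)"
      by (simp add: \<tau>_def algebra_simps)
    finally have "0 \<le> (a i - a j) * (s i - s j)" .
    moreover have "a j < a i" using ij False by (simp add: a_def)
    ultimately show ?thesis by (simp add: zero_le_mult_iff)
  qed simp
  have "U * B * quat_adjoint V = X"
  proof -
    have "U * B = X * V"
      using quat_unitary_cancel(2)[OF U, of "X * V" m] X c
      by (simp add: B_def assoc_mult_mat[of _ n n _ m _ m])
    then show ?thesis using quat_unitary_cancel(3)[OF V X] by simp
  qed
  then have "is_qsvd X U (rect_diag n m s) V"
    using U V X diag sorted unfolding is_qsvd_def B_diag
    by (auto simp: diagonal_mat_def rect_diag_def)
  then show ?thesis by (rule that)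
qed

section \<open>The proximal problem\<close>

text \<open>The diagonal need not be the sorted nonnegative one of a singular value
  decomposition. Unitary invariance only sees the squares of the entries, which suffices because
  \<^const>\<open>mcp\<close> is even.\<close>

lemma mcp_norm_real_diag:
  assumes U: "quat_unitary n U" and V: "quat_unitary m V"
  shows "mcp_norm c \<eta> (U * diag_quat n m d * quat_adjoint V) = (\<Sum>i<min n m. mcp c \<eta> (d i))"
proof -
  define X where "X = U * diag_quat n m d * quat_adjoint V"
  have X: "X \<in> carrier_mat n m"
    unfolding X_def by (rule unitary_conj_carrier[OF U V diag_quat_carrier])
  obtain U' V' s where q: "is_qsvd X U' (rect_diag n m s) V'"
    using qsvd_exists[OF X] by blast
  define t where "t = (\<lambda>i. rect_diag n m s $$ (i, i))"
  note q' = is_qsvdD[OF q X, folded t_def]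
  have abs: "mcp c \<eta> (sqrt (x\<^sup>2)) = mcp c \<eta> x" for x
    by (simp add: mcp_def)
  have "mcp_norm c \<eta> X = (\<Sum>i<min n m. mcp c \<eta> (t i))"
    using X sing_val_eq[OF q] by (simp add: mcp_norm_def t_def)
  also have "\<dots> = (\<Sum>i<min n m. mcp c \<eta> (d i))"
    using real_diag_invariant[OF U V q'(1,2) trans[OF X_def[symmetric] q'(6)],
      of "\<lambda>x. mcp c \<eta> (sqrt x)"] by (simp only: abs)
  finally show ?thesis by (simp add: X_def)
qed

lemma frob_norm_unitary_diff:
  assumes U: "quat_unitary n U" and V: "quat_unitary m V"
  shows "(frob_norm (U * diag_quat n m d * quat_adjoint V - U * diag_quat n m e * quat_adjoint V))\<^sup>2
    = (\<Sum>i<min n m. (d i - e i)\<^sup>2)"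
proof -
  note c = quat_unitaryD(1,2)[OF U] quat_unitaryD(1,2)[OF V]
  have X: "U * diag_quat n m d * quat_adjoint V \<in> carrier_mat n m" for d
    by (rule unitary_conj_carrier[OF U V diag_quat_carrier])
  have inner: "mat_inner (U * diag_quat n m d * quat_adjoint V) (U * diag_quat n m e * quat_adjoint V)
      = (\<Sum>i<min n m. d i * e i)" for d e
  proof -
    have "mat_inner (U * diag_quat n m d * quat_adjoint V) (U * diag_quat n m e * quat_adjoint V)
      = mat_inner (diag_quat n m d) (quat_adjoint U * (U * diag_quat n m e * quat_adjoint V) * V)"
      by (rule mat_inner_unitary_conj[OF U V diag_quat_carrier X])
    also have "quat_adjoint U * (U * diag_quat n m e * quat_adjoint V) * V = diag_quat n m e"
    proof -
      have "quat_adjoint U * (U * diag_quat n m e * quat_adjoint V) = diag_quat n m e * quat_adjoint V"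
        using c quat_unitary_cancel(1)[OF U mult_carrier_mat[OF diag_quat_carrier c(4)]]
        by (simp add: assoc_mult_mat[of _ n n _ m _ m])
      then show ?thesis using quat_unitary_cancel(4)[OF V diag_quat_carrier] by simp
    qed
    also have "mat_inner (diag_quat n m d) (diag_quat n m e) = (\<Sum>i<min n m. d i * e i)"
      unfolding mat_inner_diag_quat
      by (intro sum.cong refl) (simp add: diag_quat_index of_real_def del: index_map_mat)
    finally show ?thesis .
  qed
  show ?thesis
    unfolding frob_norm_power2 mat_inner_diff_self[OF X X] inner sum_distrib_left
      sum_subtractf[symmetric] sum.distrib[symmetric]
    by (intro sum.cong refl) (simp add: power2_eq_square algebra_simps)
qed

text \<open>Put \<open>h j = min\<^sub>x (\<phi> x + x\<^sup>2 / 2 - x * s j)\<close>, attained at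
  \<open>p j\<close>. After expanding the square, the claim is that the sum of the \<open>h j\<close> is at most the
  sum of \<open>\<phi> (t i) + t i\<^sup>2 / 2\<close> minus the inner product of the two matrices. That inner
  product is bounded by the sum of \<open>M i j * t i * s j\<close> with \<open>M\<close> doubly substochastic. In
  row \<open>i\<close> one uses the average over \<open>j\<close> of the inequalities defining \<open>h j\<close>; the
  missing mass of the row is harmless as \<open>\<phi>\<close> is nonnegative. The result is the sum of
  \<open>h j\<close> weighted by the column sums, and shrinking these weights below one only increases it,
  because \<open>h j\<close> is at most its value \<open>0\<close> at \<open>x = 0\<close>.\<close>

lemma separable_prox_lower_bound:
  fixes \<phi> :: "real \<Rightarrow> real" and s t p :: "nat \<Rightarrow> real"
  assumes U: "quat_unitary n U" and V: "quat_unitary m V"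
    and U': "quat_unitary n U'" and V': "quat_unitary m V'"
    and s: "\<And>i. i < min n m \<Longrightarrow> 0 \<le> s i" and t: "\<And>i. i < min n m \<Longrightarrow> 0 \<le> t i"
    and \<phi>: "\<And>x. 0 \<le> \<phi> x" "\<phi> 0 = 0"
    and p: "\<And>i x. i < min n m \<Longrightarrow> \<phi> (p i) + 1 / 2 * (p i - s i)\<^sup>2 \<le> \<phi> x + 1 / 2 * (x - s i)\<^sup>2"
  shows "(\<Sum>i<min n m. \<phi> (p i) + 1 / 2 * (p i - s i)\<^sup>2) \<le> (\<Sum>i<min n m. \<phi> (t i)) + 1 / 2 *
    (frob_norm (U' * diag_quat n m t * quat_adjoint V' - U * diag_quat n m s * quat_adjoint V))\<^sup>2"
proof -
  let ?k = "min n m"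
  define Y where "Y = U * diag_quat n m s * quat_adjoint V"
  define L where "L = U' * diag_quat n m t * quat_adjoint V'"
  note c = quat_unitaryD(1,2)[OF U] quat_unitaryD(1,2)[OF V]
    quat_unitaryD(1,2)[OF U'] quat_unitaryD(1,2)[OF V']
  have Y: "Y \<in> carrier_mat n m" and L: "L \<in> carrier_mat n m"
    unfolding Y_def L_def
    by (rule unitary_conj_carrier[OF U V diag_quat_carrier] unitary_conj_carrier[OF U' V' diag_quat_carrier])+
  define W where "W = quat_adjoint U' * U"
  define Z where "Z = quat_adjoint V * V'"
  have W: "quat_unitary n W" and Z: "quat_unitary m Z"
    by (simp_all add: W_def Z_def quat_unitary_mult quat_unitary_adjoint U U' V V')
  have self: "mat_inner (A * diag_quat n m d * quat_adjoint C) (A * diag_quat n m d * quat_adjoint C)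
      = (\<Sum>i<?k. (d i)\<^sup>2)" if A: "quat_unitary n A" and C: "quat_unitary m C" for A C d
  proof -
    have "A * diag_quat n m (\<lambda>_. 0) * quat_adjoint C = 0\<^sub>m n m"
    proof -
      have "diag_quat n m (\<lambda>_. 0) = 0\<^sub>m n m"
        by (rule eq_matI) (auto simp: rect_diag_def)
      then show ?thesis using quat_unitaryD(1,2)[OF A] quat_unitaryD(1,2)[OF C] by simp
    qed
    moreover have "A * diag_quat n m d * quat_adjoint C \<in> carrier_mat n m"
      by (rule unitary_conj_carrier[OF that diag_quat_carrier])
    moreover have "B - 0\<^sub>m n m = B" if "B \<in> carrier_mat n m" for B :: "quat mat"
      using that by (intro eq_matI) auto
    ultimately show ?thesis
      using frob_norm_unitary_diff[OF that, of d "\<lambda>_. 0"] by (simp add: frob_norm_power2)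
  qed
  obtain M where M: "\<And>i j. i < ?k \<Longrightarrow> j < ?k \<Longrightarrow> 0 \<le> M i j"
    "\<And>i. i < ?k \<Longrightarrow> (\<Sum>j<?k. M i j) \<le> 1" "\<And>j. j < ?k \<Longrightarrow> (\<Sum>i<?k. M i j) \<le> 1"
    and tr: "mat_inner (diag_quat n m t) (W * diag_quat n m s * Z) \<le> (\<Sum>i<?k. \<Sum>j<?k. M i j * (t i * s j))"
    using mat_inner_diag_le_doubly_substochastic[OF W Z, of s t, OF s t] by auto
  have "mat_inner L Y = mat_inner (diag_quat n m t) (W * diag_quat n m s * Z)"
  proof -
    have "quat_adjoint U' * Y * V' = W * diag_quat n m s * Z"
    proof -
      define S where "S = diag_quat n m s"
      have S: "S \<in> carrier_mat n m" by (simp add: S_def)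
      have "quat_adjoint U' * (U * S * quat_adjoint V) = quat_adjoint U' * (U * S) * quat_adjoint V"
        using c S by (intro assoc_mult_mat[symmetric]) auto
      also have "quat_adjoint U' * (U * S) = W * S"
        unfolding W_def using c S by (intro assoc_mult_mat[symmetric]) auto
      finally have "quat_adjoint U' * (U * S * quat_adjoint V) * V' = W * S * quat_adjoint V * V'"
        by simp
      also have "\<dots> = W * S * Z"
        unfolding Z_def using quat_unitaryD(1)[OF W] c S
        by (intro assoc_mult_mat[of _ n m _ m _ m] mult_carrier_mat[of _ n n]) auto
      finally show ?thesis by (simp add: Y_def S_def)
    qed
    then show ?thesis
      using mat_inner_unitary_conj[OF U' V' diag_quat_carrier Y, of t] by (simp add: L_def)
  qed
  with tr have LY: "mat_inner L Y \<le> (\<Sum>i<?k. \<Sum>j<?k. M i j * (t i * s j))" by simp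
  define h where "h = (\<lambda>j. \<phi> (p j) + 1 / 2 * (p j)\<^sup>2 - p j * s j)"
  have h_le: "h j \<le> \<phi> x + 1 / 2 * x\<^sup>2 - x * s j" if "j < ?k" for j x
    using p[OF that, of x] by (simp add: h_def power2_diff field_simps)
  have h_nonpos: "h j \<le> 0" if "j < ?k" for j
    using h_le[OF that, of 0] \<phi>(2) by simp
  have row: "(\<Sum>j<?k. M i j * h j) + (\<Sum>j<?k. M i j * (t i * s j)) \<le> \<phi> (t i) + 1 / 2 * (t i)\<^sup>2"
    if i: "i < ?k" for i
  proof -
    have "(\<Sum>j<?k. M i j * h j) + (\<Sum>j<?k. M i j * (t i * s j)) = (\<Sum>j<?k. M i j * (h j + t i * s j))"
      by (simp add: sum.distrib distrib_left)
    also have "\<dots> \<le> (\<Sum>j<?k. M i j * (\<phi> (t i) + 1 / 2 * (t i)\<^sup>2))"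
      using M(1)[OF i] h_le[of _ "t i"] by (intro sum_mono mult_left_mono) (auto simp: algebra_simps)
    also have "\<dots> = (\<Sum>j<?k. M i j) * (\<phi> (t i) + 1 / 2 * (t i)\<^sup>2)"
      by (simp only: sum_distrib_right)
    also have "\<dots> \<le> \<phi> (t i) + 1 / 2 * (t i)\<^sup>2"
      using M(2)[OF i] M(1)[OF i] \<phi>(1)[of "t i"] by (intro mult_left_le_one_le sum_nonneg) auto
    finally show ?thesis .
  qed
  have "(\<Sum>j<?k. h j) \<le> (\<Sum>j<?k. (\<Sum>i<?k. M i j) * h j)"
  proof (rule sum_mono)
    fix j assume "j \<in> {..<?k}"
    then show "h j \<le> (\<Sum>i<?k. M i j) * h j"
      using M(3)[of j] h_nonpos[of j] mult_right_mono_neg[of "\<Sum>i<?k. M i j" 1 "h j"] by simp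
  qed
  also have "\<dots> = (\<Sum>i<?k. \<Sum>j<?k. M i j * h j)"
    unfolding sum_distrib_right by (rule sum.swap)
  finally have col: "(\<Sum>j<?k. h j) \<le> (\<Sum>i<?k. \<Sum>j<?k. M i j * h j)" .
  have "(\<Sum>i<?k. \<Sum>j<?k. M i j * h j) + (\<Sum>i<?k. \<Sum>j<?k. M i j * (t i * s j))
      = (\<Sum>i<?k. (\<Sum>j<?k. M i j * h j) + (\<Sum>j<?k. M i j * (t i * s j)))"
    by (rule sum.distrib[symmetric])
  also have "\<dots> \<le> (\<Sum>i<?k. \<phi> (t i) + 1 / 2 * (t i)\<^sup>2)"
    using row by (intro sum_mono) simp
  finally have "(\<Sum>j<?k. h j) + mat_inner L Y \<le> (\<Sum>i<?k. \<phi> (t i) + 1 / 2 * (t i)\<^sup>2)"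
    using LY col by linarith
  moreover have "(\<Sum>i<?k. \<phi> (p i) + 1 / 2 * (p i - s i)\<^sup>2) = (\<Sum>j<?k. h j) + 1 / 2 * (\<Sum>i<?k. (s i)\<^sup>2)"
    unfolding sum_distrib_left sum.distrib[symmetric]
    by (intro sum.cong refl) (simp add: h_def power2_diff field_simps)
  moreover have "(frob_norm (L - Y))\<^sup>2 = (\<Sum>i<?k. (t i)\<^sup>2) - 2 * mat_inner L Y + (\<Sum>i<?k. (s i)\<^sup>2)"
    unfolding frob_norm_power2 mat_inner_diff_self[OF L Y]
    by (simp only: L_def Y_def self[OF U' V'] self[OF U V])
  ultimately have "(\<Sum>i<?k. \<phi> (p i) + 1 / 2 * (p i - s i)\<^sup>2)
      \<le> (\<Sum>i<?k. \<phi> (t i)) + 1 / 2 * (frob_norm (L - Y))\<^sup>2"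
    by (simp add: sum.distrib sum_distrib_left[symmetric] sum_divide_distrib[symmetric] field_simps)
  then show ?thesis by (simp only: L_def Y_def)
qed

theorem theorem2:
  fixes c \<eta> \<mu> :: real and n1 n2 :: nat
    and Y U V :: "quat mat" and S :: "real mat" and p :: "nat \<Rightarrow> real"
  assumes "0 < c" and "0 < \<eta>" and "0 < \<mu>"
    and "Y \<in> carrier_mat n1 n2"
    and "is_qsvd Y U S V"
    and "\<And>i. i < min n1 n2 \<Longrightarrow> p i \<in> prox (\<lambda>x. ereal (1 / \<mu> * mcp c \<eta> x)) (S $$ (i, i))"
  shows "is_arg_min (\<lambda>L. 1 / \<mu> * mcp_norm c \<eta> L + 1 / 2 * (frob_norm (L - Y))\<^sup>2)
    (\<lambda>L. L \<in> carrier_mat n1 n2)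
    (U * map_mat of_real (rect_diag n1 n2 p) * quat_adjoint V)"
  unfolding is_arg_min_linorder
proof (intro conjI allI impI)
  let ?k = "min n1 n2"
  define s where "s = (\<lambda>i. S $$ (i, i))"
  define \<phi> where "\<phi> = (\<lambda>x. 1 / \<mu> * mcp c \<eta> x)"
  define P where "P = U * diag_quat n1 n2 p * quat_adjoint V"
  note q = is_qsvdD[OF assms(5,4), folded s_def]
  show "U * diag_quat n1 n2 p * quat_adjoint V \<in> carrier_mat n1 n2"
    by (rule unitary_conj_carrier[OF q(1,2) diag_quat_carrier])
  have s: "\<And>i. i < ?k \<Longrightarrow> 0 \<le> s i" using q(4) by (simp add: s_def)
  have \<phi>: "\<And>x. 0 \<le> \<phi> x" "\<phi> 0 = 0"
    using assms(1-3) mcp_nonneg[OF assms(1,2)] by (simp_all add: \<phi>_def) (simp add: mcp_def)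
  have p: "\<phi> (p i) + 1 / 2 * (p i - s i)\<^sup>2 \<le> \<phi> x + 1 / 2 * (x - s i)\<^sup>2" if "i < ?k" for i x
    using assms(6)[OF that] by (simp add: prox_def is_arg_min_linorder \<phi>_def s_def)
  fix L :: "quat mat" assume L: "L \<in> carrier_mat n1 n2"
  obtain U' V' t' where q0: "is_qsvd L U' (rect_diag n1 n2 t') V'"
    using qsvd_exists[OF L] by blast
  define t where "t = (\<lambda>i. rect_diag n1 n2 t' $$ (i, i))"
  note q' = is_qsvdD[OF q0 L, folded t_def]
  have t: "\<And>i. i < ?k \<Longrightarrow> 0 \<le> t i" using q'(4) by (simp add: t_def)
  have "1 / \<mu> * mcp_norm c \<eta> P + 1 / 2 * (frob_norm (P - Y))\<^sup>2
      = (\<Sum>i<?k. \<phi> (p i) + 1 / 2 * (p i - s i)\<^sup>2)"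
    unfolding P_def
    by (subst q(6), subst frob_norm_unitary_diff[OF q(1,2)], subst mcp_norm_real_diag[OF q(1,2)])
      (simp add: \<phi>_def sum.distrib sum_distrib_left)
  also have "\<dots> \<le> (\<Sum>i<?k. \<phi> (t i)) + 1 / 2 * (frob_norm (L - Y))\<^sup>2"
    using separable_prox_lower_bound[OF q(1,2) q'(1,2), of s t \<phi> p, OF s t \<phi> p] unfolding q(6)[symmetric] q'(6)[symmetric]
    by blast
  also have "(\<Sum>i<?k. \<phi> (t i)) = 1 / \<mu> * mcp_norm c \<eta> L"
    by (subst q'(6), subst mcp_norm_real_diag[OF q'(1,2)]) (simp add: \<phi>_def sum_distrib_left)
  finally show "1 / \<mu> * mcp_norm c \<eta> (U * diag_quat n1 n2 p * quat_adjoint V)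
      + 1 / 2 * (frob_norm (U * diag_quat n1 n2 p * quat_adjoint V - Y))\<^sup>2
      \<le> 1 / \<mu> * mcp_norm c \<eta> L + 1 / 2 * (frob_norm (L - Y))\<^sup>2"
    by (simp only: P_def)
qed

end
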